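(* Let $n\geq 3$, let $\mathcal{I}\subseteq\{1,\dots,n-2\}$ be an arbitrary subset, and let $G=\mathrm{SL}(n,\mathbb{R})$. The left-translation of the subspace $\mathscr{D}_{\mathcal I}\subset\mathfrak{sl}(n,\mathbb{R})$ defines a distribution on $G$ on which the bilinear form $B(X,Y)=\mathrm{tr}(XY)$ defines a bi-invariant sub-pseudo-Riemannian metric. The corank of $\mathscr{D}_{\mathcal I}$ is $n-1-\#\mathcal{I}$, and the index of $B$ restricted to $\mathscr{D}_{\mathcal I}$ is $n(n-1)/2$.
   Context: $E_{i,j}$ is the $n\times n$ matrix with a $1$ in position $(i,j)$ and zeros elsewhere. For $\ell\in\{1,\dots,n-2\}$ put $Z_\ell=E_{n-1,n-1}-E_{\ell,\ell}$, and let $$\mathscr{D}_{\mathcal I}=\mathrm{span}\big(\{E_{p,q}+E_{q,p},\ E_{p,q}-E_{q,p} : 1\le p<q\le n\}\cup\{Z_\ell : \ell\in\mathcal{I}\}\big)\subset\mathfrak{sl}(n,\mathbb{R}).$$ The left-translation of $\mathscr{D}_{\mathcal I}$ is the vector sub-bundle of $TG$ whose fiber at $A\in G$ is $A\mathscr{D}_{\mathcal I}=\{Av : v\in\mathscr{D}_{\mathcal I}\}\subset T_AG$. The form $B$ equals $\frac{1}{2n}$ times the Killing form of $\mathfrak{sl}(n,\mathbb{R})$; it is transported to the fiber at $A$ by $(Av,Aw)\mapsto B(v,w)$. A sub-pseudo-Riemannian metric on a manifold is a smoothly varying non-degenerate symmetric bilinear form on the fibers of a bracket generating distribution; a distribution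 is bracket generating if its sections together with all their iterated Lie brackets span the tangent space at every point. Bi-invariant means invariant under both left and right translations of $G$. The corank of a distribution is $\dim G$ minus its rank. The index of a symmetric bilinear form on a vector space is the largest dimension of a subspace on which it is negative definite.
   Formalization: "Bi-invariant" is taken as: left translations preserve the distribution and the form, right translations preserve the form (on the whole tangent bundle); the distribution itself is never right-invariant, since it would be a proper nonzero ideal of sl(n,R). *)

theory Defs
  imports "HOL-Analysis.Analysis"
begin

section \<open>Smooth maps on subsets of a Euclidean space\<close>

primrec continuously_differentiable ::
    "nat \<Rightarrow> 'a::euclidean_space set \<Rightarrow> ('a \<Rightarrow> 'b::euclidean_space) \<Rightarrow> bool" where
  "continuously_differentiable 0 U f \<longleftrightarrow> continuous_on U f"
| "continuously_differentiable (Suc k) U f \<longleftrightarrow>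
     (\<forall>x\<in>U. f differentiable (at x)) \<and>
     (\<forall>v. continuously_differentiable k U (\<lambda>x. frechet_derivative f (at x) v))"

definition smooth_map_on :: "'a::euclidean_space set \<Rightarrow> ('a \<Rightarrow> 'b::euclidean_space) \<Rightarrow> bool" where
  "smooth_map_on S f \<longleftrightarrow>
     (\<forall>x\<in>S. \<exists>U F. open U \<and> x \<in> U \<and> (\<forall>k. continuously_differentiable k U F) \<and>
        (\<forall>y\<in>S \<inter> U. F y = f y))"

section \<open>Tangent spaces, distributions and Lie brackets\<close>

text \<open>Throughout, a manifold is an embedded submanifold \<open>S\<close> of a Euclidean space, and its tangent
  vectors are vectors of that space. Vector fields on \<open>S\<close> are maps of the ambient space of which
  only the values on \<open>S\<close> matter.\<close>

definition tangent_space :: "'a::euclidean_space set \<Rightarrow> 'a \<Rightarrow> 'a set" where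
  "tangent_space S x =
     {v. \<exists>(\<gamma>::real \<Rightarrow> 'a) e. e > 0 \<and> smooth_map_on {-e<..<e} \<gamma> \<and> \<gamma> ` {-e<..<e} \<subseteq> S \<and>
           \<gamma> 0 = x \<and> (\<gamma> has_vector_derivative v) (at 0)}"

definition distribution ::
    "'a::euclidean_space set \<Rightarrow> nat \<Rightarrow> ('a \<Rightarrow> 'a set) \<Rightarrow> bool" where
  "distribution S r D \<longleftrightarrow>
     (\<forall>x\<in>S. subspace (D x) \<and> dim (D x) = r \<and> D x \<subseteq> tangent_space S x) \<and>
     (\<forall>x\<in>S. \<exists>U (F :: nat \<Rightarrow> 'a \<Rightarrow> 'a). open U \<and> x \<in> U \<and>
        (\<forall>i<r. smooth_map_on (S \<inter> U) (F i)) \<and>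
        (\<forall>y\<in>S \<inter> U. inj_on (\<lambda>i. F i y) {..<r} \<and> independent ((\<lambda>i. F i y) ` {..<r}) \<and>
                    span ((\<lambda>i. F i y) ` {..<r}) = D y))"

definition corank :: "'a::euclidean_space set \<Rightarrow> ('a \<Rightarrow> 'a set) \<Rightarrow> 'a \<Rightarrow> nat" where
  "corank S D x = dim (tangent_space S x) - dim (D x)"

definition smooth_section :: "'a::euclidean_space set \<Rightarrow> ('a \<Rightarrow> 'a set) \<Rightarrow> ('a \<Rightarrow> 'a) \<Rightarrow> bool" where
  "smooth_section S D X \<longleftrightarrow> smooth_map_on S X \<and> (\<forall>x\<in>S. X x \<in> D x)"

text \<open>The derivative of a map within \<open>S\<close> is in general not unique on the ambient space, but it is
  unique on vectors tangent to \<open>S\<close>; hence for smooth fields \<open>X\<close>, \<open>Y\<close> tangent to \<open>S\<close> the following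
  does not depend on the derivative selected by \<^const>\<open>frechet_derivative\<close>, nor on the values of
  \<open>X\<close> and \<open>Y\<close> outside \<open>S\<close>.\<close>

definition lie_bracket ::
    "'a::euclidean_space set \<Rightarrow> ('a \<Rightarrow> 'a) \<Rightarrow> ('a \<Rightarrow> 'a) \<Rightarrow> 'a \<Rightarrow> 'a" where
  "lie_bracket S X Y =
     (\<lambda>x. frechet_derivative Y (at x within S) (X x) - frechet_derivative X (at x within S) (Y x))"

inductive_set iterated_brackets ::
    "'a::euclidean_space set \<Rightarrow> ('a \<Rightarrow> 'a set) \<Rightarrow> ('a \<Rightarrow> 'a) set"
  for S :: "'a set" and D :: "'a \<Rightarrow> 'a set" where
  section_mem: "smooth_section S D X \<Longrightarrow> X \<in> iterated_brackets S D"
| bracket_mem: "X \<in> iterated_brackets S D \<Longrightarrow> Y \<in> iterated_brackets S D \<Longrightarrow>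
     lie_bracket S X Y \<in> iterated_brackets S D"

definition bracket_generating :: "'a::euclidean_space set \<Rightarrow> ('a \<Rightarrow> 'a set) \<Rightarrow> bool" where
  "bracket_generating S D \<longleftrightarrow>
     (\<forall>x\<in>S. span {X x | X. X \<in> iterated_brackets S D} = tangent_space S x)"

section \<open>Bilinear forms and sub-pseudo-Riemannian metrics\<close>

definition symmetric_bilinear_on ::
    "'a::real_vector set \<Rightarrow> ('a \<Rightarrow> 'a \<Rightarrow> real) \<Rightarrow> bool" where
  "symmetric_bilinear_on V b \<longleftrightarrow>
     (\<forall>u\<in>V. \<forall>v\<in>V. b u v = b v u) \<and>
     (\<forall>u\<in>V. \<forall>v\<in>V. \<forall>w\<in>V. b (u + v) w = b u w + b v w) \<and>
     (\<forall>u\<in>V. \<forall>w\<in>V. \<forall>c. b (c *\<^sub>R u) w = c * b u w)"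

definition nondegenerate_on :: "'a::real_vector set \<Rightarrow> ('a \<Rightarrow> 'a \<Rightarrow> real) \<Rightarrow> bool" where
  "nondegenerate_on V b \<longleftrightarrow> (\<forall>u\<in>V. (\<forall>v\<in>V. b u v = 0) \<longrightarrow> u = 0)"

definition form_index :: "'a::euclidean_space set \<Rightarrow> ('a \<Rightarrow> 'a \<Rightarrow> real) \<Rightarrow> nat" where
  "form_index V b =
     Max {dim W | W. subspace W \<and> W \<subseteq> V \<and> (\<forall>w\<in>W. w \<noteq> 0 \<longrightarrow> b w w < 0)}"

definition sub_pseudo_Riemannian_metric ::
    "'a::euclidean_space set \<Rightarrow> ('a \<Rightarrow> 'a set) \<Rightarrow> ('a \<Rightarrow> 'a \<Rightarrow> 'a \<Rightarrow> real) \<Rightarrow> bool" where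
  "sub_pseudo_Riemannian_metric S D g \<longleftrightarrow>
     (\<exists>r. distribution S r D) \<and> bracket_generating S D \<and>
     (\<forall>x\<in>S. symmetric_bilinear_on (D x) (g x) \<and> nondegenerate_on (D x) (g x)) \<and>
     (\<forall>X Y. smooth_section S D X \<longrightarrow> smooth_section S D Y \<longrightarrow>
        smooth_map_on S (\<lambda>x. g x (X x) (Y x)))"

section \<open>The special linear group\<close>

definition SL :: "(real^'n^'n) set" where
  "SL = {A. det A = 1}"

definition left_translation ::
    "(real^'n^'n) set \<Rightarrow> real^'n^'n \<Rightarrow> (real^'n^'n) set" where
  "left_translation V A = (\<lambda>v. A ** v) ` V"

definition left_translated_form ::
    "(real^'n^'n \<Rightarrow> real^'n^'n \<Rightarrow> real) \<Rightarrow>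
     real^'n^'n \<Rightarrow> real^'n^'n \<Rightarrow> real^'n^'n \<Rightarrow> real" where
  "left_translated_form b A X Y = b (matrix_inv A ** X) (matrix_inv A ** Y)"

text \<open>Left and right multiplications are linear, so they are their own differentials. Left
  translations are required to preserve both the distribution and the form. A proper nonzero
  left-invariant distribution on \<open>SL(n,\<real>)\<close> is never preserved by all right translations, since
  its fiber at the identity would be a proper nonzero ideal of a simple Lie algebra; so
  invariance under right translations is a condition on the form. It is imposed, like left
  invariance, on all tangent vectors, so that \<open>g\<close> is the restriction to \<open>D\<close> of a form on the whole
  tangent bundle invariant under both kinds of translation.\<close>

definition bi_invariant_metric ::
    "(real^'n^'n) set \<Rightarrow> (real^'n^'n \<Rightarrow> (real^'n^'n) set) \<Rightarrow>
     (real^'n^'n \<Rightarrow> real^'n^'n \<Rightarrow> real^'n^'n \<Rightarrow> real) \<Rightarrow> bool" where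
  "bi_invariant_metric G D g \<longleftrightarrow>
     (\<forall>A\<in>G. \<forall>C\<in>G. (\<lambda>X. C ** X) ` D A = D (C ** A)) \<and>
     (\<forall>A\<in>G. \<forall>C\<in>G. \<forall>X\<in>tangent_space G A. \<forall>Y\<in>tangent_space G A.
        g (C ** A) (C ** X) (C ** Y) = g A X Y \<and>
        g (A ** C) (X ** C) (Y ** C) = g A X Y)"

text \<open>The finite index type \<open>'n\<close> is numbered by a bijection \<open>e\<close> from \<open>{1..CARD('n)}\<close>.\<close>

definition mat_unit :: "(nat \<Rightarrow> 'n) \<Rightarrow> nat \<Rightarrow> nat \<Rightarrow> real^'n^'n" where
  "mat_unit e p q = (\<chi> i j. if i = e p \<and> j = e q then 1 else 0)"

definition Z_mat :: "(nat \<Rightarrow> 'n) \<Rightarrow> nat \<Rightarrow> real^'n^'n" where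
  "Z_mat e l = mat_unit e (CARD('n) - 1) (CARD('n) - 1) - mat_unit e l l"

definition D_space :: "(nat \<Rightarrow> 'n) \<Rightarrow> nat set \<Rightarrow> (real^'n^'n) set" where
  "D_space e I = span
     ({mat_unit e p q + mat_unit e q p | p q. 1 \<le> p \<and> p < q \<and> q \<le> CARD('n)} \<union>
      {mat_unit e p q - mat_unit e q p | p q. 1 \<le> p \<and> p < q \<and> q \<le> CARD('n)} \<union>
      Z_mat e ` I)"

definition trace_form :: "real^'n^'n \<Rightarrow> real^'n^'n \<Rightarrow> real" where
  "trace_form X Y = trace (X ** Y)"

end

theory Submission
  imports Defs
begin

text \<open>The tangent space of \<open>SL\<close> at \<open>A\<close> consists of the \<open>A w\<close> with \<open>trace w = 0\<close>. Brackets of tangent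
  fields are tangent, and the brackets of left-invariant fields are the matrix commutators. Since
  \<open>D\<^sub>I\<close> contains all off-diagonal matrix units, and \<open>[E\<^sub>i\<^sub>j, E\<^sub>j\<^sub>i] = E\<^sub>i\<^sub>i - E\<^sub>j\<^sub>j\<close>, one bracket already
  yields every trace-free matrix. The form is nondegenerate because \<open>D\<^sub>I\<close> is closed under
  transposition and \<open>B(u, transpose u) = |u|\<^sup>2\<close>; it is negative definite on the skew-symmetric
  matrices and positive definite on the symmetric ones, which gives the index.\<close>

section \<open>Smooth maps\<close>

text \<open>The obstacle is that \<open>SL\<close> has empty interior: a derivative
  \<open>at x within SL\<close> is not unique, and \<open>frechet_derivative\<close> merely selects
  one. Smooth maps are therefore handled through local extensions to open sets, and derivatives are
  evaluated only on tangent vectors, where velocities of curves determine them. Bracket generation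
  quantifies over all smooth sections, so tangency has to be shown for brackets of arbitrary tangent
  fields, whereas spanning needs only the left-invariant ones. The geometric lemmas are stated for a
  general \<open>V\<close>, with hypotheses such as trace zero, closure under transposition or
  containing the off-diagonal units. The set \<open>I\<close> enters through the diagonal generators
  alone; these are symmetric, so they add to the rank but not to the index. The corank is (n^2 - 1)
  - (n^2 - n + \<open>card I\<close>).\<close>

lemma frechet_derivative_eq:
  "(f has_derivative f') (at x) \<Longrightarrow> frechet_derivative f (at x) = f'"
  using frechet_derivative_at by metis

text \<open>On an open set, agreement holds near each point and so passes to derivatives. This lets
  the closure lemmas below replace the selected \<open>frechet_derivative\<close> by the explicit
  formula of a differentiation rule.\<close>

lemma continuously_differentiable_cong:
  assumes "open U" "\<And>x. x \<in> U \<Longrightarrow> f x = g x" "continuously_differentiable k U f"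
  shows "continuously_differentiable k U g"
  using assms
proof (induction k arbitrary: f g)
  case 0
  then show ?case by (auto cong: continuous_on_cong)
next
  case (Suc k)
  have *: "(g has_derivative frechet_derivative f (at x)) (at x)" if "x \<in> U" for x
  proof (rule has_derivative_transform_within_open[of f _ x UNIV U g])
    show "(f has_derivative frechet_derivative f (at x)) (at x)"
      using Suc.prems(3) that by (simp add: frechet_derivative_works)
  qed (use Suc.prems that in auto)
  have eq: "frechet_derivative g (at x) = frechet_derivative f (at x)" if "x \<in> U" for x
    using *[OF that] frechet_derivative_eq by blast
  have "continuously_differentiable k U (\<lambda>x. frechet_derivative g (at x) v)" for v
    by (rule Suc.IH[OF \<open>open U\<close>, of "\<lambda>x. frechet_derivative f (at x) v"]) (use Suc.prems eq in simp_all)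
  then show ?case
    using * by (simp add: differentiable_def) blast
qed

lemma continuously_differentiable_subset:
  "continuously_differentiable k U f \<Longrightarrow> V \<subseteq> U \<Longrightarrow> continuously_differentiable k V f"
  by (induction k arbitrary: f) (auto intro: continuous_on_subset)

lemma continuously_differentiable_SucD:
  "continuously_differentiable (Suc k) U f \<Longrightarrow> continuously_differentiable k U f"
proof (induction k arbitrary: f)
  case 0
  then show ?case
    by (auto intro!: continuous_at_imp_continuous_on differentiable_imp_continuous_within)
qed auto

text \<open>Zero comes before general constants because the induction closes on it: the derivative
  of zero is zero again. A constant then needs only one differentiation.\<close>

lemma continuously_differentiable_zero:
  "continuously_differentiable k U (\<lambda>_. 0)"
  by (induction k) (auto simp: frechet_derivative_eq[OF has_derivative_const])

lemma continuously_differentiable_const: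
  "continuously_differentiable k U (\<lambda>_. c)"
  by (cases k) (auto simp: frechet_derivative_eq[OF has_derivative_const]
      continuously_differentiable_zero)

lemma continuously_differentiable_bounded_linear:
  "bounded_linear f \<Longrightarrow> continuously_differentiable k U f"
  by (cases k) (auto simp: frechet_derivative_eq[OF bounded_linear.has_derivative[OF _ has_derivative_ident]]
      continuously_differentiable_const bounded_linear_imp_differentiable
      intro: linear_continuous_on)

lemma continuously_differentiable_add:
  assumes "open U" "continuously_differentiable k U f" "continuously_differentiable k U g"
  shows "continuously_differentiable k U (\<lambda>x. f x + g x)"
  using assms(2,3)
proof (induction k arbitrary: f g)
  case (Suc k)
  have D: "((\<lambda>x. f x + g x) has_derivative
      (\<lambda>v. frechet_derivative f (at x) v + frechet_derivative g (at x) v)) (at x)"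
    if "x \<in> U" for x
    using Suc.prems that by (auto intro!: has_derivative_add simp: frechet_derivative_works)
  have E: "continuously_differentiable k U
      (\<lambda>x. frechet_derivative f (at x) v + frechet_derivative g (at x) v)" for v
    using Suc by auto
  have "continuously_differentiable k U (\<lambda>x. frechet_derivative (\<lambda>x. f x + g x) (at x) v)" for v
    by (rule continuously_differentiable_cong[OF \<open>open U\<close> _ E[of v]])
       (simp add: frechet_derivative_eq[OF D])
  then show ?case
    using D by (auto simp: differentiable_def)
qed (auto intro: continuous_intros)

text \<open>The product rule yields two products, each with one factor differentiated, so the
  induction has to range over both factors. The undifferentiated factor is needed at the lower
  order, which \<open>continuously_differentiable_SucD\<close> supplies.\<close>

lemma continuously_differentiable_bilinear:
  assumes "bounded_bilinear h" "open U"
    and "continuously_differentiable k U f" "continuously_differentiable k U g"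
  shows "continuously_differentiable k U (\<lambda>x. h (f x) (g x))"
  using assms(3,4)
proof (induction k arbitrary: f g)
  case 0
  then show ?case by (auto intro: bounded_bilinear.continuous_on[OF assms(1)])
next
  case (Suc k)
  have D: "((\<lambda>x. h (f x) (g x)) has_derivative
      (\<lambda>v. h (f x) (frechet_derivative g (at x) v) + h (frechet_derivative f (at x) v) (g x))) (at x)"
    if "x \<in> U" for x
    using Suc.prems that
    by (auto intro!: bounded_bilinear.FDERIV[OF assms(1)] simp: frechet_derivative_works)
  have E: "continuously_differentiable k U
      (\<lambda>x. h (f x) (frechet_derivative g (at x) v) + h (frechet_derivative f (at x) v) (g x))" for v
    using Suc.prems Suc.prems[THEN continuously_differentiable_SucD]
    by (intro continuously_differentiable_add assms Suc.IH) auto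
  have "continuously_differentiable k U
      (\<lambda>x. frechet_derivative (\<lambda>x. h (f x) (g x)) (at x) v)" for v
    by (rule continuously_differentiable_cong[OF \<open>open U\<close> _ E[of v]])
       (simp add: frechet_derivative_eq[OF D])
  then show ?case
    using D by (auto simp: differentiable_def)
qed

text \<open>The derivative of the reciprocal is a product of \<open>f'\<close> with two copies of
  the same reciprocal, to which the induction hypothesis applies.\<close>

lemma continuously_differentiable_inverse:
  fixes f :: "'a::euclidean_space \<Rightarrow> real"
  assumes "open U" "\<And>x. x \<in> U \<Longrightarrow> f x \<noteq> 0" "continuously_differentiable k U f"
  shows "continuously_differentiable k U (\<lambda>x. inverse (f x))"
  using assms(3)
proof (induction k)
  case 0
  then show ?case using assms(2) by (auto intro: continuous_on_inverse)
next
  case (Suc k)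
  have D: "((\<lambda>x. inverse (f x)) has_derivative
      (\<lambda>v. - (inverse (f x) * frechet_derivative f (at x) v * inverse (f x)))) (at x)"
    if "x \<in> U" for x
    using Suc.prems that assms(2)
    by (auto intro!: Deriv.has_derivative_inverse simp: frechet_derivative_works)
  \<comment> \<open>The sign is written as a factor \<open>- 1\<close> so that the product lemma
    covers the whole expression.\<close>
  have E: "continuously_differentiable k U
      (\<lambda>x. - 1 * (inverse (f x) * frechet_derivative f (at x) v * inverse (f x)))" for v
    using Suc continuously_differentiable_SucD[OF Suc.prems]
    by (intro continuously_differentiable_bilinear[OF bounded_bilinear_mult]
        continuously_differentiable_const assms(1)) auto
  have "continuously_differentiable k U (\<lambda>x. frechet_derivative (\<lambda>x. inverse (f x)) (at x) v)" for v
    by (rule continuously_differentiable_cong[OF \<open>open U\<close> _ E[of v]])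
       (simp add: frechet_derivative_eq[OF D])
  then show ?case
    using D by (auto simp: differentiable_def)
qed

section \<open>Smooth maps on arbitrary subsets, through local extensions\<close>

lemma smooth_map_onE:
  assumes "smooth_map_on S f" "x \<in> S"
  obtains U F where "open U" "x \<in> U" "\<forall>k. continuously_differentiable k U F"
    "\<forall>y\<in>S \<inter> U. F y = f y"
  using assms unfolding smooth_map_on_def by blast

lemma smooth_map_onI:
  assumes "\<And>x. x \<in> S \<Longrightarrow> \<exists>U F. open U \<and> x \<in> U \<and> (\<forall>k. continuously_differentiable k U F) \<and>
        (\<forall>y\<in>S \<inter> U. F y = f y)"
  shows "smooth_map_on S f"
  using assms unfolding smooth_map_on_def by blast

lemma smooth_map_on_cong:
  assumes "smooth_map_on S f" "\<And>x. x \<in> S \<Longrightarrow> f x = g x"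
  shows "smooth_map_on S g"
proof (rule smooth_map_onI)
  fix x assume "x \<in> S"
  obtain U F where "open U" "x \<in> U" "\<forall>k. continuously_differentiable k U F"
    "\<forall>y\<in>S \<inter> U. F y = f y" by (rule smooth_map_onE[OF assms(1) \<open>x \<in> S\<close>])
  then show "\<exists>U F. open U \<and> x \<in> U \<and> (\<forall>k. continuously_differentiable k U F) \<and>
        (\<forall>y\<in>S \<inter> U. F y = g y)"
    using assms(2) by (intro exI[of _ U] exI[of _ F]) auto
qed

lemma smooth_map_on_subset:
  assumes "smooth_map_on S f" "T \<subseteq> S"
  shows "smooth_map_on T f"
proof (rule smooth_map_onI)
  fix x assume "x \<in> T"
  with assms have "x \<in> S" by blast
  obtain U F where "open U" "x \<in> U" "\<forall>k. continuously_differentiable k U F"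
    "\<forall>y\<in>S \<inter> U. F y = f y" by (rule smooth_map_onE[OF assms(1) \<open>x \<in> S\<close>])
  then show "\<exists>U F. open U \<and> x \<in> U \<and> (\<forall>k. continuously_differentiable k U F) \<and>
        (\<forall>y\<in>T \<inter> U. F y = f y)"
    using assms(2) by (intro exI[of _ U] exI[of _ F]) auto
qed

lemma smooth_map_on_bounded_linear: "bounded_linear f \<Longrightarrow> smooth_map_on S f"
  using continuously_differentiable_bounded_linear unfolding smooth_map_on_def by blast

lemma smooth_map_on_const: "smooth_map_on S (\<lambda>_. c)"
  using continuously_differentiable_const unfolding smooth_map_on_def by blast

lemma smooth_map_on_bilinear:
  assumes "bounded_bilinear h" "smooth_map_on S f" "smooth_map_on S g"
  shows "smooth_map_on S (\<lambda>x. h (f x) (g x))"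
proof (rule smooth_map_onI)
  fix x assume "x \<in> S"
  obtain U F where U: "open U" "x \<in> U" "\<forall>k. continuously_differentiable k U F"
    "\<forall>y\<in>S \<inter> U. F y = f y" by (rule smooth_map_onE[OF assms(2) \<open>x \<in> S\<close>])
  obtain V G where V: "open V" "x \<in> V" "\<forall>k. continuously_differentiable k V G"
    "\<forall>y\<in>S \<inter> V. G y = g y" by (rule smooth_map_onE[OF assms(3) \<open>x \<in> S\<close>])
  have "continuously_differentiable k (U \<inter> V) (\<lambda>x. h (F x) (G x))" for k
    by (rule continuously_differentiable_bilinear[OF assms(1) open_Int[OF U(1) V(1)]
        continuously_differentiable_subset[OF U(3)[rule_format] Int_lower1]
        continuously_differentiable_subset[OF V(3)[rule_format] Int_lower2]])
  then show "\<exists>U F. open U \<and> x \<in> U \<and> (\<forall>k. continuously_differentiable k U F) \<and>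
        (\<forall>y\<in>S \<inter> U. F y = h (f y) (g y))"
    using U V by (intro exI[of _ "U \<inter> V"] exI[of _ "\<lambda>x. h (F x) (G x)"]) auto
qed

lemma smooth_map_on_add:
  assumes "smooth_map_on S f" "smooth_map_on S g"
  shows "smooth_map_on S (\<lambda>x. f x + g x)"
proof (rule smooth_map_onI)
  fix x assume "x \<in> S"
  obtain U F where U: "open U" "x \<in> U" "\<forall>k. continuously_differentiable k U F"
    "\<forall>y\<in>S \<inter> U. F y = f y" by (rule smooth_map_onE[OF assms(1) \<open>x \<in> S\<close>])
  obtain V G where V: "open V" "x \<in> V" "\<forall>k. continuously_differentiable k V G"
    "\<forall>y\<in>S \<inter> V. G y = g y" by (rule smooth_map_onE[OF assms(2) \<open>x \<in> S\<close>])
  have "continuously_differentiable k (U \<inter> V) (\<lambda>x. F x + G x)" for k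
    by (rule continuously_differentiable_add[OF open_Int[OF U(1) V(1)]
        continuously_differentiable_subset[OF U(3)[rule_format] Int_lower1]
        continuously_differentiable_subset[OF V(3)[rule_format] Int_lower2]])
  then show "\<exists>U F. open U \<and> x \<in> U \<and> (\<forall>k. continuously_differentiable k U F) \<and>
        (\<forall>y\<in>S \<inter> U. F y = f y + g y)"
    using U V by (intro exI[of _ "U \<inter> V"] exI[of _ "\<lambda>x. F x + G x"]) auto
qed

lemma smooth_map_on_scaleR:
  "smooth_map_on S f \<Longrightarrow> smooth_map_on S g \<Longrightarrow> smooth_map_on S (\<lambda>x. f x *\<^sub>R g x)"
  by (rule smooth_map_on_bilinear[OF bounded_bilinear_scaleR])

lemma smooth_map_on_mult:
  fixes f g :: "'a::euclidean_space \<Rightarrow> real"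
  shows "smooth_map_on S f \<Longrightarrow> smooth_map_on S g \<Longrightarrow> smooth_map_on S (\<lambda>x. f x * g x)"
  by (rule smooth_map_on_bilinear[OF bounded_bilinear_mult])

lemma smooth_map_on_diff:
  assumes "smooth_map_on S f" "smooth_map_on S g"
  shows "smooth_map_on S (\<lambda>x. f x - g x)"
  using smooth_map_on_add[OF assms(1) smooth_map_on_scaleR[OF smooth_map_on_const[of _ "-1"] assms(2)]]
  by simp

lemma smooth_map_on_sum:
  assumes "\<And>i. i \<in> J \<Longrightarrow> smooth_map_on S (f i)"
  shows "smooth_map_on S (\<lambda>x. \<Sum>i\<in>J. f i x)"
  using assms by (induction J rule: infinite_finite_induct)
    (auto intro: smooth_map_on_add smooth_map_on_const)

lemma smooth_map_on_prod:
  fixes f :: "'i \<Rightarrow> 'a::euclidean_space \<Rightarrow> real"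
  assumes "\<And>i. i \<in> J \<Longrightarrow> smooth_map_on S (f i)"
  shows "smooth_map_on S (\<lambda>x. \<Prod>i\<in>J. f i x)"
  using assms by (induction J rule: infinite_finite_induct)
    (auto intro: smooth_map_on_mult smooth_map_on_const)

lemma smooth_map_on_inverse:
  fixes f :: "'a::euclidean_space \<Rightarrow> real"
  assumes "smooth_map_on S f" "\<And>x. x \<in> S \<Longrightarrow> f x \<noteq> 0"
  shows "smooth_map_on S (\<lambda>x. inverse (f x))"
proof (rule smooth_map_onI)
  fix x assume "x \<in> S"
  obtain U F where U: "open U" "x \<in> U" "\<forall>k. continuously_differentiable k U F"
    "\<forall>y\<in>S \<inter> U. F y = f y" by (rule smooth_map_onE[OF assms(1) \<open>x \<in> S\<close>])
  \<comment> \<open>The extension \<open>F\<close> may vanish at points of \<open>U\<close> outside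
    \<open>S\<close>, so its zeros are removed.\<close>
  define V where "V = U \<inter> F -` (- {0})"
  have "continuous_on U F" using U(3)[rule_format, of 0] by simp
  then have V: "open V" unfolding V_def
    using U(1) by (intro continuous_open_preimage) auto
  have "continuously_differentiable k V (\<lambda>x. inverse (F x))" for k
    by (intro continuously_differentiable_inverse V
        continuously_differentiable_subset[OF U(3)[rule_format]]) (auto simp: V_def)
  then show "\<exists>U F. open U \<and> x \<in> U \<and> (\<forall>k. continuously_differentiable k U F) \<and>
        (\<forall>y\<in>S \<inter> U. F y = inverse (f y))"
    using U V \<open>x \<in> S\<close> assms(2)
    by (intro exI[of _ V] exI[of _ "\<lambda>x. inverse (F x)"]) (auto simp: V_def)
qed

lemma smooth_map_on_componentwise:
  assumes "\<And>b. b \<in> Basis \<Longrightarrow> smooth_map_on S (\<lambda>x. f x \<bullet> b)"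
  shows "smooth_map_on S f"
proof -
  have "smooth_map_on S (\<lambda>x. \<Sum>b\<in>Basis. (f x \<bullet> b) *\<^sub>R b)"
    by (intro smooth_map_on_sum smooth_map_on_scaleR smooth_map_on_const assms)
  then show ?thesis by (simp add: euclidean_representation)
qed

section \<open>Matrix-valued maps: determinant, product, trace and inverse\<close>

lemma smooth_map_on_matrixI:
  fixes f :: "'a::euclidean_space \<Rightarrow> real^'n^'m"
  assumes "\<And>i j. smooth_map_on S (\<lambda>x. f x $ i $ j)"
  shows "smooth_map_on S f"
  by (rule smooth_map_on_componentwise) (auto simp: Basis_vec_def inner_axis assms)

lemma smooth_map_on_matrixD:
  fixes f :: "'a::euclidean_space \<Rightarrow> real^'n^'m"
  assumes "smooth_map_on S f"
  shows "smooth_map_on S (\<lambda>x. f x $ i $ j)"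
  using smooth_map_on_bilinear[OF bounded_bilinear_inner assms smooth_map_on_const[of _ "axis i (axis j 1)"]]
  by (simp add: inner_axis)

lemma smooth_map_on_det:
  fixes f :: "'a::euclidean_space \<Rightarrow> real^'n^'n"
  assumes "smooth_map_on S f"
  shows "smooth_map_on S (\<lambda>x. det (f x))"
  unfolding det_def
  by (intro smooth_map_on_sum smooth_map_on_mult smooth_map_on_prod smooth_map_on_const
      smooth_map_on_matrixD assms)

lemma smooth_map_on_matrix_mult:
  fixes f g :: "'a::euclidean_space \<Rightarrow> real^'n^'n"
  assumes "smooth_map_on S f" "smooth_map_on S g"
  shows "smooth_map_on S (\<lambda>x. f x ** g x)"
  by (rule smooth_map_on_matrixI)
    (auto simp: matrix_matrix_mult_def
      intro!: smooth_map_on_sum smooth_map_on_mult smooth_map_on_matrixD assms)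

lemma smooth_map_on_trace:
  fixes f :: "'a::euclidean_space \<Rightarrow> real^'n^'n"
  assumes "smooth_map_on S f"
  shows "smooth_map_on S (\<lambda>x. trace (f x))"
  unfolding trace_def by (intro smooth_map_on_sum smooth_map_on_matrixD assms)

lemma matrix_inv_works:
  fixes A :: "real^'n^'n"
  assumes "det A \<noteq> 0"
  shows "A ** matrix_inv A = mat 1" "matrix_inv A ** A = mat 1"
  using assms someI_ex[of "\<lambda>A'. A ** A' = mat 1 \<and> A' ** A = mat 1"]
  unfolding matrix_inv_def invertible_det_nz[symmetric] invertible_def by auto

text \<open>Column \<open>l\<close> of the inverse solves the linear system with right-hand side
  column \<open>l\<close> of \<open>mat 1\<close>, so Cramer's rule applies. It exhibits the entries
  as rational functions of \<open>A\<close>, from which smoothness of inversion follows.\<close>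

lemma matrix_inv_eq_cramer:
  fixes A :: "real^'n^'n"
  assumes "det A \<noteq> 0"
  shows "matrix_inv A $ k $ l = det (\<chi> i j. if j = k then mat 1 $ i $ l else A $ i $ j) / det A"
proof -
  have "A *v column l (matrix_inv A) = column l (mat 1)"
    using arg_cong[OF matrix_inv_works(1)[OF assms], of "column l"]
    by (simp add: vec_eq_iff column_def matrix_vector_mult_def matrix_matrix_mult_def)
  from this[unfolded cramer[OF assms]] have "column l (matrix_inv A) $ k =
     det (\<chi> i j. if j = k then column l (mat 1) $ i else A $ i $ j) / det A"
    by (metis (no_types, lifting) vec_lambda_beta)
  then show ?thesis by (simp add: column_def mat_def cong: if_cong)
qed

lemma smooth_map_on_matrix_inv:
  fixes f :: "'a::euclidean_space \<Rightarrow> real^'n^'n"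
  assumes "smooth_map_on S f" "\<And>x. x \<in> S \<Longrightarrow> det (f x) \<noteq> 0"
  shows "smooth_map_on S (\<lambda>x. matrix_inv (f x))"
proof (rule smooth_map_on_matrixI)
  fix k l
  have "smooth_map_on S (\<lambda>x. \<chi> i j. if j = k then mat 1 $ i $ l else f x $ i $ j)"
  proof (rule smooth_map_on_matrixI)
    fix i j
    show "smooth_map_on S (\<lambda>x. (\<chi> i j. if j = k then mat 1 $ i $ l else f x $ i $ j) $ i $ j)"
      by (cases "j = k") (auto intro: smooth_map_on_const smooth_map_on_matrixD assms)
  qed
  then have "smooth_map_on S (\<lambda>x. det (\<chi> i j. if j = k then mat 1 $ i $ l else f x $ i $ j)
      * inverse (det (f x)))"
    by (intro smooth_map_on_mult smooth_map_on_det smooth_map_on_inverse assms)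
  then show "smooth_map_on S (\<lambda>x. matrix_inv (f x) $ k $ l)"
    by (rule smooth_map_on_cong) (simp add: matrix_inv_eq_cramer assms divide_inverse)
qed

section \<open>Derivatives along tangent vectors\<close>

text \<open>An extension that works on \<open>S \<inter> U\<close> works on \<open>S\<close> after
  shrinking its domain to lie in \<open>U\<close>. This serves maps whose formula involves a local
  extension and is thus available only near each point.\<close>

lemma smooth_map_on_local:
  assumes "\<And>x. x \<in> S \<Longrightarrow> \<exists>U. open U \<and> x \<in> U \<and> smooth_map_on (S \<inter> U) f"
  shows "smooth_map_on S f"
proof (rule smooth_map_onI)
  fix x assume "x \<in> S"
  then obtain U where U: "open U" "x \<in> U" "smooth_map_on (S \<inter> U) f" using assms by blast
  with \<open>x \<in> S\<close> have "x \<in> S \<inter> U" by blast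
  obtain V F where V: "open V" "x \<in> V" "\<forall>k. continuously_differentiable k V F"
    "\<forall>y\<in>S \<inter> U \<inter> V. F y = f y" by (rule smooth_map_onE[OF U(3) \<open>x \<in> S \<inter> U\<close>])
  show "\<exists>U F. open U \<and> x \<in> U \<and> (\<forall>k. continuously_differentiable k U F) \<and>
        (\<forall>y\<in>S \<inter> U. F y = f y)"
  proof (intro exI[of _ "U \<inter> V"] exI[of _ F] conjI allI)
    show "continuously_differentiable k (U \<inter> V) F" for k
      by (rule continuously_differentiable_subset[OF V(3)[rule_format] Int_lower2])
  qed (use U V in auto)
qed

lemma has_derivative_within_transform_open:
  assumes "(F has_derivative F') (at x within S)" "open U" "x \<in> U" "x \<in> S" "\<forall>y\<in>S \<inter> U. F y = f y"
  shows "(f has_derivative F') (at x within S)"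
proof -
  obtain d where "d > 0" "ball x d \<subseteq> U" using assms(2,3) openE by blast
  then show ?thesis
    using assms(4,5)
    by (intro has_derivative_transform_within[OF assms(1) \<open>d > 0\<close>]) (auto simp: dist_commute subset_iff)
qed

text \<open>The ambient derivative of a local extension is also a derivative within
  \<open>S\<close>. Hence the choice behind \<open>frechet_derivative\<close> is a genuine
  derivative, though perhaps a different one.\<close>

lemma smooth_map_on_has_derivative:
  assumes "smooth_map_on S f" "x \<in> S"
  shows "(f has_derivative frechet_derivative f (at x within S)) (at x within S)"
proof -
  obtain U F where U: "open U" "x \<in> U" "\<forall>k. continuously_differentiable k U F"
    "\<forall>y\<in>S \<inter> U. F y = f y" by (rule smooth_map_onE[OF assms])
  have "(F has_derivative frechet_derivative F (at x)) (at x)"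
    using U(2) U(3)[rule_format, of "Suc 0"] by (simp add: frechet_derivative_works)
  then have "(F has_derivative frechet_derivative F (at x)) (at x within S)"
    by (rule has_derivative_at_withinI)
  then have "(f has_derivative frechet_derivative F (at x)) (at x within S)"
    by (rule has_derivative_within_transform_open[OF _ U(1,2) assms(2) U(4)])
  then show ?thesis
    using frechet_derivative_works differentiableI by blast
qed

lemma tangent_spaceI:
  fixes \<gamma> :: "real \<Rightarrow> 'a::euclidean_space"
  assumes "e > 0" "smooth_map_on {-e<..<e} \<gamma>" "\<gamma> ` {-e<..<e} \<subseteq> S" "\<gamma> 0 = x"
    "(\<gamma> has_vector_derivative v) (at 0)"
  shows "v \<in> tangent_space S x"
  unfolding tangent_space_def using assms by blast

text \<open>Composing with a curve in \<open>S\<close> trades a possibly ambiguous derivative within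
  \<open>S\<close> for an ordinary one at an interior point of an interval, which is unique.\<close>

lemma tangent_space_curve_derivative:
  assumes "(f has_derivative f') (at x within S)" "v \<in> tangent_space S x"
  obtains \<gamma> :: "real \<Rightarrow> 'a::euclidean_space" and e where
    "e > 0" "\<gamma> ` {-e<..<e} \<subseteq> S" "\<gamma> 0 = x" "((\<lambda>t. f (\<gamma> t)) has_vector_derivative f' v) (at 0)"
proof -
  obtain \<gamma> :: "real \<Rightarrow> 'a" and e where g: "e > 0" "\<gamma> ` {-e<..<e} \<subseteq> S" "\<gamma> 0 = x"
    "(\<gamma> has_vector_derivative v) (at 0)"
    using assms(2) unfolding tangent_space_def by blast
  have "(\<gamma> has_derivative (\<lambda>t. t *\<^sub>R v)) (at 0 within {-e<..<e})"
    using g(4) unfolding has_vector_derivative_def by (rule has_derivative_at_withinI)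
  moreover have "(f has_derivative f') (at (\<gamma> 0) within \<gamma> ` {-e<..<e})"
    using has_derivative_subset[OF assms(1) g(2)] g(3) by simp
  ultimately have "((\<lambda>t. f (\<gamma> t)) has_derivative (\<lambda>t. f' (t *\<^sub>R v))) (at 0 within {-e<..<e})"
    by (rule has_derivative_in_compose)
  then have "((\<lambda>t. f (\<gamma> t)) has_derivative (\<lambda>t. f' (t *\<^sub>R v))) (at 0)"
    using at_within_open[of 0 "{-e<..<e}"] g(1) by simp
  moreover have "f' (t *\<^sub>R v) = t *\<^sub>R f' v" for t
    using has_derivative_linear[OF assms(1)] by (simp add: linear_cmul)
  ultimately have "((\<lambda>t. f (\<gamma> t)) has_vector_derivative f' v) (at 0)"
    by (simp add: has_vector_derivative_def)
  with g show ?thesis using that by blast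
qed

text \<open>The difference \<open>f1 - f2\<close> is a derivative of the zero map within
  \<open>S\<close>; along a curve with velocity \<open>v\<close>, its value at \<open>v\<close> is
  the velocity of a constant. The later evaluations of brackets rest on this.\<close>

lemma has_derivative_unique_tangent:
  assumes "(f has_derivative f1) (at x within S)" "(f has_derivative f2) (at x within S)"
    and "v \<in> tangent_space S x"
  shows "f1 v = f2 v"
proof -
  have "((\<lambda>y. 0) has_derivative (\<lambda>v. f1 v - f2 v)) (at x within S)"
    using has_derivative_diff[OF assms(1,2)] by simp
  from tangent_space_curve_derivative[OF this assms(3)]
  have "((\<lambda>t::real. 0) has_vector_derivative f1 v - f2 v) (at 0)" by metis
  then show ?thesis
    using vector_derivative_unique_at[OF has_vector_derivative_const] by (metis eq_iff_diff_eq_0)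
qed

text \<open>The derivative within \<open>S\<close> is selected point by point, so nothing makes it
  vary smoothly by itself. On the tangent vector \<open>X x\<close> it agrees with the derivative of
  a local extension \<open>F\<close>, and expanding \<open>X x\<close> in \<open>Basis\<close>
  leaves only smooth coefficients and directional derivatives of \<open>F\<close>.\<close>

lemma smooth_map_on_directional_derivative:
  assumes "smooth_map_on S X" "smooth_map_on S Y" "\<And>x. x \<in> S \<Longrightarrow> X x \<in> tangent_space S x"
  shows "smooth_map_on S (\<lambda>x. frechet_derivative Y (at x within S) (X x))"
proof (rule smooth_map_on_local)
  fix x assume "x \<in> S"
  obtain U F where U: "open U" "x \<in> U" "\<forall>k. continuously_differentiable k U F"
    "\<forall>y\<in>S \<inter> U. F y = Y y" by (rule smooth_map_onE[OF assms(2) \<open>x \<in> S\<close>])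
  have "continuously_differentiable k U (\<lambda>y. frechet_derivative F (at y) b)" for k b
    using U(3)[rule_format, of "Suc k"] by simp
  then have "smooth_map_on (S \<inter> U) (\<lambda>y. frechet_derivative F (at y) b)" for b
    using U(1,2) unfolding smooth_map_on_def by blast
  moreover have "smooth_map_on (S \<inter> U) X"
    using assms(1) by (rule smooth_map_on_subset) blast
  ultimately have "smooth_map_on (S \<inter> U) (\<lambda>y. \<Sum>b\<in>Basis. (X y \<bullet> b) *\<^sub>R frechet_derivative F (at y) b)"
    by (intro smooth_map_on_sum smooth_map_on_scaleR smooth_map_on_const
        smooth_map_on_bilinear[OF bounded_bilinear_inner])
  then have "smooth_map_on (S \<inter> U) (\<lambda>x. frechet_derivative Y (at x within S) (X x))"
  proof (rule smooth_map_on_cong)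
    fix y assume y: "y \<in> S \<inter> U"
    have D: "(F has_derivative frechet_derivative F (at y)) (at y)"
      using y U(3)[rule_format, of "Suc 0"] by (simp add: frechet_derivative_works)
    have "(Y has_derivative frechet_derivative F (at y)) (at y within S)"
      by (rule has_derivative_within_transform_open[OF has_derivative_at_withinI[OF D] U(1) _ _ U(4)])
         (use y in auto)
    moreover have "(Y has_derivative frechet_derivative Y (at y within S)) (at y within S)"
      using smooth_map_on_has_derivative[OF assms(2)] y by blast
    ultimately have "frechet_derivative Y (at y within S) (X y) = frechet_derivative F (at y) (X y)"
      using has_derivative_unique_tangent assms(3) y by blast
    also have "\<dots> = frechet_derivative F (at y) (\<Sum>b\<in>Basis. (X y \<bullet> b) *\<^sub>R b)"
      by (simp add: euclidean_representation)
    also have "\<dots> = (\<Sum>b\<in>Basis. (X y \<bullet> b) *\<^sub>R frechet_derivative F (at y) b)"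
      using has_derivative_linear[OF D] by (simp add: linear_sum linear_cmul)
    finally show "(\<Sum>b\<in>Basis. (X y \<bullet> b) *\<^sub>R frechet_derivative F (at y) b)
      = frechet_derivative Y (at y within S) (X y)" by simp
  qed
  then show "\<exists>U. open U \<and> x \<in> U \<and>
      smooth_map_on (S \<inter> U) (\<lambda>x. frechet_derivative Y (at x within S) (X x))"
    using U by blast
qed

lemma smooth_map_on_lie_bracket:
  assumes "smooth_map_on S X" "smooth_map_on S Y"
    and "\<And>x. x \<in> S \<Longrightarrow> X x \<in> tangent_space S x" "\<And>x. x \<in> S \<Longrightarrow> Y x \<in> tangent_space S x"
  shows "smooth_map_on S (lie_bracket S X Y)"
  unfolding lie_bracket_def
  by (intro smooth_map_on_diff smooth_map_on_directional_derivative assms)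

section \<open>The tangent space of the special linear group\<close>

lemma bounded_bilinear_matrix_mult:
  "bounded_bilinear ((**) :: real^'n^'n \<Rightarrow> real^'n^'n \<Rightarrow> real^'n^'n)"
  unfolding bilinear_conv_bounded_bilinear[symmetric] bilinear_def
  by (auto intro!: linearI simp: vec_eq_iff matrix_matrix_mult_def sum.distrib
      distrib_left distrib_right sum_distrib_left mult_ac)

lemmas has_derivative_matrix_mult = bounded_bilinear.FDERIV[OF bounded_bilinear_matrix_mult]
lemmas matrix_mult_bilinear_simps =
  bounded_bilinear.add_left[OF bounded_bilinear_matrix_mult]
  bounded_bilinear.add_right[OF bounded_bilinear_matrix_mult]
  bounded_bilinear.diff_left[OF bounded_bilinear_matrix_mult]
  bounded_bilinear.diff_right[OF bounded_bilinear_matrix_mult]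
  bounded_bilinear.scaleR_left[OF bounded_bilinear_matrix_mult]
  bounded_bilinear.scaleR_right[OF bounded_bilinear_matrix_mult]
  bounded_bilinear.zero_left[OF bounded_bilinear_matrix_mult]
  bounded_bilinear.zero_right[OF bounded_bilinear_matrix_mult]

lemma linear_matrix_mult_left: "linear (\<lambda>X :: real^'n^'n. A ** X)" for A :: "real^'n^'n"
  using bounded_bilinear.bounded_linear_right[OF bounded_bilinear_matrix_mult]
  by (rule bounded_linear.linear)

lemma bounded_linear_matrix_mult_right: "bounded_linear (\<lambda>X :: real^'n^'n. X ** A)" for A :: "real^'n^'n"
  by (rule bounded_bilinear.bounded_linear_left[OF bounded_bilinear_matrix_mult])

lemma bounded_linear_trace: "bounded_linear (trace :: real^'n^'n \<Rightarrow> real)"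
  unfolding linear_conv_bounded_linear[symmetric] trace_def
  by (auto intro!: linearI simp: sum.distrib sum_distrib_left)

lemma trace_scaleR: "trace (c *\<^sub>R A) = c * trace A" for A :: "real^'n^'n"
  by (simp add: trace_def sum_distrib_left)

text \<open>Differentiating the Leibniz sum factor by factor, only the identity permutation survives
  at \<open>mat 1\<close>.\<close>

lemma has_derivative_det_mat_1:
  "((det :: real^'n^'n \<Rightarrow> real) has_derivative trace) (at (mat 1))"
proof -
  have "((det :: real^'n^'n \<Rightarrow> real) has_derivative (\<lambda>W. \<Sum>p | p permutes (UNIV :: 'n set).
      of_int (sign p) * (\<Sum>i\<in>UNIV. W $ i $ p i * (\<Prod>j\<in>UNIV - {i}. mat 1 $ j $ p j)))) (at (mat 1))"
    unfolding det_def
    by (intro has_derivative_sum has_derivative_mult_right has_derivative_prod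
        bounded_linear.has_derivative[OF bounded_linear_vec_nth] has_derivative_ident)
  moreover have "(\<Sum>p | p permutes (UNIV :: 'n set).
      of_int (sign p) * (\<Sum>i\<in>UNIV. W $ i $ p i * (\<Prod>j\<in>UNIV - {i}. mat 1 $ j $ p j))) = trace W"
    for W :: "real^'n^'n"
  proof -
    have zero: "(\<Prod>j\<in>UNIV - {i}. mat 1 $ j $ p j) = (0::real)"
      if "p permutes UNIV" "p \<noteq> id" for p :: "'n \<Rightarrow> 'n" and i
    proof -
      \<comment> \<open>A permutation that moves \<open>j\<close> also moves \<open>p j\<close>,
        hence at least two points. One of them differs from the omitted index \<open>i\<close> and
        contributes an off-diagonal zero of \<open>mat 1\<close>.\<close>
      obtain j where j: "p j \<noteq> j" using \<open>p \<noteq> id\<close> by (auto simp: fun_eq_iff)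
      then have "p (p j) \<noteq> p j" using injD[OF permutes_inj[OF that(1)]] by blast
      with j obtain k where "k \<noteq> i" "p k \<noteq> k" by metis
      then have "mat 1 $ k $ p k = (0::real)" by (simp add: mat_def)
      with \<open>k \<noteq> i\<close> show ?thesis by (intro prod_zero) auto
    qed
    have "(\<Sum>p | p permutes (UNIV :: 'n set).
        of_int (sign p) * (\<Sum>i\<in>UNIV. W $ i $ p i * (\<Prod>j\<in>UNIV - {i}. mat 1 $ j $ p j)))
      = (\<Sum>p \<in> {id}. of_int (sign p) * (\<Sum>i\<in>UNIV. W $ i $ p i * (\<Prod>j\<in>UNIV - {i}. mat 1 $ j $ p j)))"
    proof (intro sum.mono_neutral_right ballI)
      fix p :: "'n \<Rightarrow> 'n" assume "p \<in> {p. p permutes UNIV} - {id}"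
      then show "of_int (sign p) * (\<Sum>i\<in>UNIV. W $ i $ p i * (\<Prod>j\<in>UNIV - {i}. mat 1 $ j $ p j)) = 0"
        using zero[of p] by (simp del: prod_zero_iff)
    qed (auto simp: permutes_id finite_permutations)
    then show ?thesis by (simp add: trace_def mat_def sign_id)
  qed
  ultimately show ?thesis by (simp only:)
qed

lemma SL_inverse:
  assumes "A \<in> SL"
  shows "A ** matrix_inv A = mat 1" "matrix_inv A ** A = mat 1"
  using assms matrix_inv_works[of A] by (auto simp: SL_def)

text \<open>Multiplication by \<open>matrix_inv x\<close> moves the base point to the identity,
  where the derivative of \<open>det\<close> is \<open>trace\<close>; the resulting map is
  constantly 1 on \<open>SL\<close>.\<close>

lemma trace_tangent_SL:
  fixes x :: "real^'n^'n"
  assumes "x \<in> SL" "v \<in> tangent_space SL x"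
  shows "trace (matrix_inv x ** v) = 0"
proof -
  have "((\<lambda>y. matrix_inv x ** y) has_derivative (\<lambda>v. matrix_inv x ** v)) (at x within SL)"
    by (intro bounded_linear_imp_has_derivative
        bounded_bilinear.bounded_linear_right[OF bounded_bilinear_matrix_mult])
  moreover have "(det has_derivative trace) (at (matrix_inv x ** x))"
    using has_derivative_det_mat_1 SL_inverse[OF assms(1)] by simp
  ultimately have D: "((\<lambda>y. det (matrix_inv x ** y)) has_derivative (\<lambda>v. trace (matrix_inv x ** v)))
      (at x within SL)"
    by (rule has_derivative_compose)
  have eq: "1 = det (matrix_inv x ** y)" if "y \<in> SL" for y
    using that assms SL_inverse(2)[OF assms(1)] det_mul[of "matrix_inv x" x]
    by (simp add: SL_def det_mul)
  have "((\<lambda>y. 1) has_derivative (\<lambda>v. trace (matrix_inv x ** v))) (at x within SL)"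
    by (rule has_derivative_transform[OF assms(1) eq D])
  from has_derivative_unique_tangent[OF this has_derivative_const assms(2)] show ?thesis .
qed

text \<open>The curve \<open>x (1 + t w)\<close> leaves \<open>SL\<close>, which is repaired by dividing one row of \<open>1 + t w\<close> by
  the determinant; this does not change the velocity at \<open>0\<close> since \<open>trace w = 0\<close>.\<close>

lemma tangent_space_SL_superset:
  fixes x w :: "real^'n^'n"
  assumes "x \<in> SL" "trace w = 0"
  shows "x ** w \<in> tangent_space SL x"
proof -
  define k :: 'n where "k = undefined"
  define P :: "real^'n^'n" where "P = (\<chi> i j. if i = k \<and> j = k then 1 else 0)"
  define M where "M = (\<lambda>t::real. mat 1 + t *\<^sub>R w)"
  define c where "c = (\<lambda>t. inverse (det (M t)))"
  define \<gamma> where "\<gamma> = (\<lambda>t. x ** ((mat 1 + (c t - 1) *\<^sub>R P) ** M t))"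
  have M: "(M has_derivative (\<lambda>t. t *\<^sub>R w)) (at 0)"
    unfolding M_def
    using has_derivative_add[OF has_derivative_const has_derivative_scaleR_left[OF has_derivative_ident]]
    by simp
  have M0: "M 0 = mat 1" by (simp add: M_def)
  have "((\<lambda>t. det (M t)) has_derivative (\<lambda>t. trace (t *\<^sub>R w))) (at 0)"
    by (rule has_derivative_compose[OF M]) (simp add: M0 has_derivative_det_mat_1)
  then have d: "((\<lambda>t. det (M t)) has_derivative (\<lambda>t. 0)) (at 0)"
    by (simp add: trace_scaleR assms(2))
  \<comment> \<open>Within distance 1 of \<open>det (M 0) = 1\<close> the determinant cannot vanish;
    this fixes the radius \<open>e\<close> on which \<open>c\<close> is smooth.\<close>
  have "\<forall>\<^sub>F t in at 0. dist (det (M t)) (det (M 0)) < 1"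
    using has_derivative_continuous[OF d] unfolding continuous_within
    by (rule tendstoD) simp
  then obtain e where e: "e > 0" "\<And>t. t \<noteq> 0 \<Longrightarrow> \<bar>t\<bar> < e \<Longrightarrow> dist (det (M t)) (det (M 0)) < 1"
    unfolding eventually_at by (auto simp: dist_real_def)
  have det_nz: "det (M t) \<noteq> 0" if "t \<in> {-e<..<e}" for t
    using e(2)[of t] that by (cases "t = 0") (auto simp: M0 dist_real_def abs_less_iff)
  have c: "(c has_derivative (\<lambda>t. 0)) (at 0)"
    unfolding c_def using Deriv.has_derivative_inverse[OF _ d] by (simp add: M0)
  have c0: "c 0 = 1" by (simp add: c_def M0)
  have smM: "smooth_map_on T M" for T
    unfolding M_def
    by (rule smooth_map_on_add[OF smooth_map_on_const smooth_map_on_scaleR[OF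
          smooth_map_on_bounded_linear[OF bounded_linear_ident] smooth_map_on_const]])
  have smc: "smooth_map_on {-e<..<e} c"
    unfolding c_def by (intro smooth_map_on_inverse smooth_map_on_det smM det_nz)
  have "smooth_map_on {-e<..<e} \<gamma>"
    unfolding \<gamma>_def
    by (intro smooth_map_on_add smooth_map_on_const smooth_map_on_scaleR smooth_map_on_matrix_mult
        smooth_map_on_diff smM smc)
  have in_SL: "\<gamma> t \<in> SL" if "t \<in> {-e<..<e}" for t
  proof -
    have "det (mat 1 + (c t - 1) *\<^sub>R P) = (\<Prod>i\<in>UNIV. (mat 1 + (c t - 1) *\<^sub>R P) $ i $ i)"
      by (rule det_diagonal) (auto simp: P_def mat_def)
    also have "\<dots> = (\<Prod>i\<in>UNIV. if i = k then c t else 1)"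
      by (intro prod.cong) (auto simp: P_def mat_def)
    also have "\<dots> = c t" by simp
    finally show ?thesis
      using assms(1) det_nz[OF that] by (simp add: \<gamma>_def SL_def det_mul c_def)
  qed
  have "\<gamma> 0 = x" by (simp add: \<gamma>_def c0 M0)
  have "(\<gamma> has_vector_derivative x ** w) (at 0)"
  proof -
    have "((\<lambda>t. mat 1 + (c t - 1) *\<^sub>R P) has_derivative (\<lambda>t. 0)) (at 0)"
      using has_derivative_add[OF has_derivative_const has_derivative_scaleR_left[OF
          has_derivative_diff[OF c has_derivative_const]]] by simp
    from has_derivative_matrix_mult[OF has_derivative_const[of x] has_derivative_matrix_mult[OF this M]]
    have "(\<gamma> has_derivative (\<lambda>t. x ** (t *\<^sub>R w))) (at 0)"
      unfolding \<gamma>_def by (simp add: c0 M0 matrix_mult_bilinear_simps)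
    then show ?thesis by (simp add: has_vector_derivative_def matrix_mult_bilinear_simps)
  qed
  show ?thesis
  proof (rule tangent_spaceI)
    show "\<gamma> ` {-e<..<e} \<subseteq> SL" using in_SL by blast
  qed fact+
qed

lemma tangent_space_SL:
  fixes x :: "real^'n^'n"
  assumes "x \<in> SL"
  shows "tangent_space SL x = left_translation {w. trace w = 0} x"
proof (intro equalityI subsetI)
  fix v assume "v \<in> tangent_space SL x"
  then have "trace (matrix_inv x ** v) = 0" by (rule trace_tangent_SL[OF assms])
  moreover have "v = x ** (matrix_inv x ** v)"
    by (simp add: matrix_mul_assoc SL_inverse[OF assms])
  ultimately show "v \<in> left_translation {w. trace w = 0} x"
    unfolding left_translation_def by (intro image_eqI[of _ _ "matrix_inv x ** v"]) simp_all
next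
  fix v assume "v \<in> left_translation {w. trace w = 0} x"
  then obtain w where "v = x ** w" "trace w = 0" unfolding left_translation_def by blast
  then show "v \<in> tangent_space SL x" using tangent_space_SL_superset[OF assms] by simp
qed

section \<open>Left-invariant distributions\<close>

text \<open>Smoothness and tangency have to be carried together: the next bracket differentiates
  these fields, and its derivatives are determined only on tangent vectors.\<close>

lemma iterated_brackets_smooth_tangent:
  assumes "\<And>x. x \<in> S \<Longrightarrow> D x \<subseteq> tangent_space S x"
    and bracket: "\<And>X Y x. smooth_map_on S X \<Longrightarrow> smooth_map_on S Y \<Longrightarrow>
      (\<And>x. x \<in> S \<Longrightarrow> X x \<in> tangent_space S x) \<Longrightarrow> (\<And>x. x \<in> S \<Longrightarrow> Y x \<in> tangent_space S x) \<Longrightarrow>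
      x \<in> S \<Longrightarrow> lie_bracket S X Y x \<in> tangent_space S x"
    and "X \<in> iterated_brackets S D"
  shows "smooth_map_on S X \<and> (\<forall>x\<in>S. X x \<in> tangent_space S x)"
  using assms(3)
proof induction
  case (section_mem X)
  then show ?case using assms(1) by (auto simp: smooth_section_def)
next
  case (bracket_mem X Y)
  then show ?case by (simp add: smooth_map_on_lie_bracket bracket)
qed

text \<open>In the left trivialization \<open>X x = x \<xi>(x)\<close>, \<open>Y x = x \<eta>(x)\<close> the bracket at \<open>x\<close> is
  \<open>x (\<xi>\<eta> - \<eta>\<xi> + d\<eta>(X) - d\<xi>(Y))\<close>, and every term in parentheses has trace zero.\<close>

lemma trivialization_SL_derivative:
  fixes Y :: "real^'n^'n \<Rightarrow> real^'n^'n"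
  assumes "smooth_map_on SL Y" "\<And>x. x \<in> SL \<Longrightarrow> Y x \<in> tangent_space SL x"
    and "x \<in> SL" "v \<in> tangent_space SL x"
  obtains w where "trace w = 0"
    "frechet_derivative Y (at x within SL) v = x ** w + v ** (matrix_inv x ** Y x)"
proof -
  define \<eta> where "\<eta> = (\<lambda>y. matrix_inv y ** Y y)"
  define \<eta>' where "\<eta>' = frechet_derivative \<eta> (at x within SL)"
  have "smooth_map_on SL (\<lambda>y :: real^'n^'n. matrix_inv y)"
    by (rule smooth_map_on_matrix_inv[OF smooth_map_on_bounded_linear[OF bounded_linear_ident]])
       (simp add: SL_def)
  then have "smooth_map_on SL \<eta>"
    unfolding \<eta>_def by (rule smooth_map_on_matrix_mult[OF _ assms(1)])
  then have d\<eta>: "(\<eta> has_derivative \<eta>') (at x within SL)"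
    unfolding \<eta>'_def by (rule smooth_map_on_has_derivative[OF _ assms(3)])
  \<comment> \<open>Tangency of \<open>Y\<close> makes \<open>trace (\<eta> y)\<close> vanish on
    \<open>SL\<close>, so this derivative and the zero map must agree at the tangent vector
    \<open>v\<close>.\<close>
  have "((\<lambda>y. trace (\<eta> y)) has_derivative (\<lambda>v. trace (\<eta>' v))) (at x within SL)"
    by (rule bounded_linear.has_derivative[OF bounded_linear_trace d\<eta>])
  moreover have "((\<lambda>y. trace (\<eta> y)) has_derivative (\<lambda>v. 0)) (at x within SL)"
    by (rule has_derivative_transform[OF assms(3) _ has_derivative_const[of 0]])
       (simp add: \<eta>_def trace_tangent_SL assms(2))
  ultimately have "trace (\<eta>' v) = 0"
    by (rule has_derivative_unique_tangent[OF _ _ assms(4)])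
  moreover have "((\<lambda>y. y ** \<eta> y) has_derivative (\<lambda>v. x ** \<eta>' v + v ** \<eta> x)) (at x within SL)"
    by (rule has_derivative_matrix_mult[OF has_derivative_ident d\<eta>])
  then have "(Y has_derivative (\<lambda>v. x ** \<eta>' v + v ** \<eta> x)) (at x within SL)"
    by (rule has_derivative_transform[OF assms(3), rotated])
       (simp add: \<eta>_def matrix_mul_assoc SL_inverse)
  then have "frechet_derivative Y (at x within SL) v = x ** \<eta>' v + v ** \<eta> x"
    by (rule has_derivative_unique_tangent[OF smooth_map_on_has_derivative[OF assms(1,3)] _ assms(4)])
  ultimately show ?thesis using that unfolding \<eta>_def by blast
qed

lemma lie_bracket_SL_tangent:
  fixes X Y :: "real^'n^'n \<Rightarrow> real^'n^'n"
  assumes "smooth_map_on SL X" "smooth_map_on SL Y"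
    and "\<And>x. x \<in> SL \<Longrightarrow> X x \<in> tangent_space SL x" "\<And>x. x \<in> SL \<Longrightarrow> Y x \<in> tangent_space SL x"
    and "x \<in> SL"
  shows "lie_bracket SL X Y x \<in> tangent_space SL x"
proof -
  define a where "a = matrix_inv x ** X x"
  define b where "b = matrix_inv x ** Y x"
  have a: "X x = x ** a" and b: "Y x = x ** b"
    by (simp_all add: a_def b_def matrix_mul_assoc SL_inverse assms(5))
  obtain u where u: "trace u = 0" "frechet_derivative Y (at x within SL) (X x) = x ** u + X x ** b"
    using trivialization_SL_derivative[OF assms(2,4,5) assms(3)[OF assms(5)]] unfolding b_def by blast
  obtain w where w: "trace w = 0" "frechet_derivative X (at x within SL) (Y x) = x ** w + Y x ** a"
    using trivialization_SL_derivative[OF assms(1,3,5) assms(4)[OF assms(5)]] unfolding a_def by blast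
  have "lie_bracket SL X Y x = x ** (u + a ** b - (w + b ** a))"
    unfolding lie_bracket_def u(2) w(2)
    by (simp add: matrix_mult_bilinear_simps matrix_mul_assoc a b)
  moreover have "trace (u + a ** b - (w + b ** a)) = 0"
    by (simp add: trace_add trace_sub u w trace_mul_sym[of a b])
  ultimately show ?thesis
    using tangent_space_SL_superset[OF assms(5)] by simp
qed

text \<open>Each field is the restriction of a linear map, which is its own derivative. The trace
  hypotheses make both fields tangent, so the selected derivatives take these values on
  them.\<close>

lemma lie_bracket_left_invariant:
  fixes a b :: "real^'n^'n"
  assumes "x \<in> SL" "trace a = 0" "trace b = 0"
  shows "lie_bracket SL (\<lambda>y. y ** a) (\<lambda>y. y ** b) x = x ** (a ** b - b ** a)"
proof -
  have D: "frechet_derivative (\<lambda>y. y ** c) (at x within SL) v = v ** c"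
    if "v \<in> tangent_space SL x" for c v :: "real^'n^'n"
  proof (rule has_derivative_unique_tangent[OF _ _ that])
    show "((\<lambda>y. y ** c) has_derivative (\<lambda>v. v ** c)) (at x within SL)"
      by (rule bounded_linear_imp_has_derivative[OF bounded_linear_matrix_mult_right])
    show "((\<lambda>y. y ** c) has_derivative frechet_derivative (\<lambda>y. y ** c) (at x within SL)) (at x within SL)"
      by (rule smooth_map_on_has_derivative[OF
            smooth_map_on_bounded_linear[OF bounded_linear_matrix_mult_right] assms(1)])
  qed
  show ?thesis
    unfolding lie_bracket_def
    by (simp add: D tangent_space_SL_superset[OF assms(1)] assms(2,3) matrix_mult_bilinear_simps
        matrix_mul_assoc)
qed

lemma subspace_trace_0: "subspace {w :: real^'n^'n. trace w = 0}"
  by (auto simp: subspace_def trace_add trace_scaleR) (simp add: trace_def)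

lemma span_left_translation: "span (left_translation V A) = left_translation (span V) A"
  unfolding left_translation_def by (rule linear_span_image[OF linear_matrix_mult_left])

text \<open>This reduces the condition at every point to one on the Lie algebra: translates of
  elements of \<open>V\<close> are sections, and their brackets are translates of commutators. The
  opposite inclusion concerns arbitrary sections and uses
  \<open>lie_bracket_SL_tangent\<close>.\<close>

lemma bracket_generating_SL:
  fixes V :: "(real^'n^'n) set"
  assumes V: "V \<subseteq> {w. trace w = 0}"
    and gen: "{w. trace w = 0} \<subseteq> span (V \<union> {a ** b - b ** a | a b. a \<in> V \<and> b \<in> V})"
  shows "bracket_generating SL (left_translation V)"
  unfolding bracket_generating_def
proof (intro ballI equalityI)
  fix x :: "real^'n^'n" assume x: "x \<in> SL"
  let ?B = "{X x | X. X \<in> iterated_brackets SL (left_translation V)}"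
  have "left_translation V y \<subseteq> tangent_space SL y" if "y \<in> SL" for y
    using V tangent_space_SL[OF that] by (auto simp: left_translation_def)
  then have "smooth_map_on SL X \<and> (\<forall>x\<in>SL. X x \<in> tangent_space SL x)"
    if "X \<in> iterated_brackets SL (left_translation V)" for X
    by (rule iterated_brackets_smooth_tangent[OF _ lie_bracket_SL_tangent that])
  then have "?B \<subseteq> tangent_space SL x" using x by blast
  moreover have "subspace (tangent_space SL x)"
    unfolding tangent_space_SL[OF x] left_translation_def
    by (intro linear_subspace_image linear_matrix_mult_left subspace_trace_0)
  ultimately show "span ?B \<subseteq> tangent_space SL x" by (rule span_minimal)
  have sec: "(\<lambda>y. y ** a) \<in> iterated_brackets SL (left_translation V)" if "a \<in> V" for a
  proof (rule iterated_brackets.section_mem)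
    show "smooth_section SL (left_translation V) (\<lambda>y. y ** a)"
      using that smooth_map_on_bounded_linear[OF bounded_linear_matrix_mult_right]
      by (auto simp: smooth_section_def left_translation_def)
  qed
  have "x ** w \<in> ?B" if w: "w \<in> V \<union> {a ** b - b ** a | a b. a \<in> V \<and> b \<in> V}" for w
  proof -
    consider "w \<in> V" | a b where "w = a ** b - b ** a" "a \<in> V" "b \<in> V"
      using w by blast
    then show ?thesis
    proof cases
      case 1
      show ?thesis using sec[OF 1] by (intro CollectI exI[of _ "\<lambda>y. y ** w"]) simp
    next
      case 2
      then have "x ** w = lie_bracket SL (\<lambda>y. y ** a) (\<lambda>y. y ** b) x"
        using V x by (subst lie_bracket_left_invariant) auto
      with iterated_brackets.bracket_mem[OF sec[OF 2(2)] sec[OF 2(3)]] show ?thesis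
        by (intro CollectI exI[of _ "lie_bracket SL (\<lambda>y. y ** a) (\<lambda>y. y ** b)"]) simp
    qed
  qed
  then have "left_translation (V \<union> {a ** b - b ** a | a b. a \<in> V \<and> b \<in> V}) x \<subseteq> ?B"
    unfolding left_translation_def by (rule image_subsetI)
  then have "left_translation (span (V \<union> {a ** b - b ** a | a b. a \<in> V \<and> b \<in> V})) x \<subseteq> span ?B"
    unfolding span_left_translation[symmetric] by (rule span_mono)
  with gen show "tangent_space SL x \<subseteq> span ?B"
    unfolding tangent_space_SL[OF x] left_translation_def by (meson image_mono order_trans)
qed

lemma inj_matrix_mult_SL: "A \<in> SL \<Longrightarrow> inj (\<lambda>X :: real^'n^'n. A ** X)"
  by (rule inj_on_inverseI[of _ "\<lambda>X. matrix_inv A ** X"]) (simp add: matrix_mul_assoc SL_inverse)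

lemma dim_left_translation:
  fixes A :: "real^'n^'n"
  assumes "A \<in> SL"
  shows "dim (left_translation V A) = dim V"
  unfolding left_translation_def
  by (rule dim_image_eq[OF linear_matrix_mult_left inj_on_subset[OF inj_matrix_mult_SL[OF assms]]]) simp

text \<open>Translating a basis of \<open>V\<close> gives a global frame of left-invariant fields,
  so \<open>UNIV\<close> serves as the neighbourhood of every point.\<close>

lemma distribution_SL:
  fixes V :: "(real^'n^'n) set"
  assumes "subspace V" "V \<subseteq> {w. trace w = 0}"
  shows "distribution SL (dim V) (left_translation V)"
  unfolding distribution_def
proof (intro conjI ballI)
  fix x :: "real^'n^'n" assume x: "x \<in> SL"
  show "subspace (left_translation V x)"
    unfolding left_translation_def by (intro linear_subspace_image linear_matrix_mult_left assms)
  show "dim (left_translation V x) = dim V" by (rule dim_left_translation[OF x])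
  show "left_translation V x \<subseteq> tangent_space SL x"
    unfolding tangent_space_SL[OF x] left_translation_def by (rule image_mono[OF assms(2)])
  obtain B where B: "B \<subseteq> V" "independent B" "V \<subseteq> span B" "card B = dim V"
    using basis_exists[of V] by blast
  have "finite B" using B(2) by (rule independent_imp_finite)
  then obtain h where "bij_betw h {0..<card B} B" using ex_bij_betw_nat_finite by blast
  then have h: "bij_betw h {..<dim V} B" using B(4) by (simp add: atLeast0LessThan)
  have hB: "h ` {..<dim V} = B" using h by (rule bij_betw_imp_surj_on)
  have spanB: "span B = V"
    using B assms(1) span_minimal by blast
  have "inj_on (\<lambda>i. y ** h i) {..<dim V} \<and> independent ((\<lambda>i. y ** h i) ` {..<dim V}) \<and>
      span ((\<lambda>i. y ** h i) ` {..<dim V}) = left_translation V y" if "y \<in> SL" for y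
  proof (intro conjI)
    have im: "(\<lambda>i. y ** h i) ` {..<dim V} = (\<lambda>X. y ** X) ` B"
      unfolding hB[symmetric] by (simp add: image_image)
    show "inj_on (\<lambda>i. y ** h i) {..<dim V}"
      using comp_inj_on[OF bij_betw_imp_inj_on[OF h] inj_on_subset[OF inj_matrix_mult_SL[OF that]]]
      by (simp add: comp_def)
    show "independent ((\<lambda>i. y ** h i) ` {..<dim V})"
      unfolding im
      by (rule linear_independent_injective_image[OF linear_matrix_mult_left B(2)
            inj_on_subset[OF inj_matrix_mult_SL[OF that] subset_UNIV]])
    show "span ((\<lambda>i. y ** h i) ` {..<dim V}) = left_translation V y"
      unfolding im linear_span_image[OF linear_matrix_mult_left] spanB left_translation_def ..
  qed
  moreover have "smooth_map_on T (\<lambda>y :: real^'n^'n. y ** h i)" for T i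
    by (rule smooth_map_on_bounded_linear[OF bounded_linear_matrix_mult_right])
  ultimately show "\<exists>U (F :: nat \<Rightarrow> real^'n^'n \<Rightarrow> real^'n^'n). open U \<and> x \<in> U \<and>
      (\<forall>i<dim V. smooth_map_on (SL \<inter> U) (F i)) \<and>
      (\<forall>y\<in>SL \<inter> U. inj_on (\<lambda>i. F i y) {..<dim V} \<and> independent ((\<lambda>i. F i y) ` {..<dim V}) \<and>
        span ((\<lambda>i. F i y) ` {..<dim V}) = left_translation V y)"
    by (intro exI[of _ UNIV] exI[of _ "\<lambda>i y. y ** h i"]) simp
qed

section \<open>Bi-invariance and nondegeneracy of the trace form, and the corank\<close>

lemma matrix_inv_mult_SL:
  fixes A C :: "real^'n^'n"
  assumes "A \<in> SL" "C \<in> SL"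
  shows "matrix_inv (A ** C) = matrix_inv C ** matrix_inv A"
proof -
  have "A ** C \<in> SL" using assms by (simp add: SL_def det_mul)
  have "matrix_inv C ** matrix_inv A = matrix_inv C ** matrix_inv A ** (A ** C ** matrix_inv (A ** C))"
    by (simp add: SL_inverse[OF \<open>A ** C \<in> SL\<close>])
  also have "\<dots> = matrix_inv C ** (matrix_inv A ** A) ** C ** matrix_inv (A ** C)"
    by (simp only: matrix_mul_assoc)
  also have "\<dots> = matrix_inv (A ** C)"
    by (simp add: SL_inverse assms)
  finally show ?thesis by simp
qed

text \<open>A left translation cancels in the left trivialization; a right translation by
  \<open>C\<close> conjugates it by \<open>C\<close>, and the trace of a product is invariant under
  simultaneous conjugation.\<close>

lemma bi_invariant_trace_form:
  "bi_invariant_metric SL (left_translation V) (left_translated_form trace_form)"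
  for V :: "(real^'n^'n) set"
  unfolding bi_invariant_metric_def
proof (intro conjI ballI)
  fix A C :: "real^'n^'n" assume A: "A \<in> SL" and C: "C \<in> SL"
  show "(\<lambda>X. C ** X) ` left_translation V A = left_translation V (C ** A)"
    by (simp add: left_translation_def image_image matrix_mul_assoc)
  fix X Y :: "real^'n^'n"
  have "matrix_inv (C ** A) ** (C ** Z) = matrix_inv A ** Z" for Z :: "real^'n^'n"
  proof -
    have "matrix_inv (C ** A) ** (C ** Z) = matrix_inv A ** (matrix_inv C ** C) ** Z"
      by (simp only: matrix_inv_mult_SL[OF C A] matrix_mul_assoc)
    then show ?thesis by (simp add: SL_inverse[OF C])
  qed
  then show "left_translated_form trace_form (C ** A) (C ** X) (C ** Y)
      = left_translated_form trace_form A X Y"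
    by (simp add: left_translated_form_def)
  have conj: "matrix_inv (A ** C) ** (Z ** C) = matrix_inv C ** (matrix_inv A ** Z) ** C" for Z :: "real^'n^'n"
    by (simp only: matrix_inv_mult_SL[OF A C] matrix_mul_assoc)
  have "trace ((matrix_inv C ** P ** C) ** (matrix_inv C ** Q ** C)) = trace (P ** Q)" for P Q :: "real^'n^'n"
  proof -
    have "(matrix_inv C ** P ** C) ** (matrix_inv C ** Q ** C)
        = matrix_inv C ** (P ** (C ** matrix_inv C) ** Q ** C)"
      by (simp only: matrix_mul_assoc)
    also have "\<dots> = matrix_inv C ** (P ** Q ** C)" by (simp add: SL_inverse[OF C])
    also have "trace \<dots> = trace (P ** Q ** C ** matrix_inv C)" by (rule trace_mul_sym)
    also have "P ** Q ** C ** matrix_inv C = P ** Q ** (C ** matrix_inv C)"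
      by (simp only: matrix_mul_assoc)
    finally show ?thesis by (simp add: SL_inverse[OF C])
  qed
  then show "left_translated_form trace_form (A ** C) (X ** C) (Y ** C)
      = left_translated_form trace_form A X Y"
    by (simp add: left_translated_form_def trace_form_def conj)
qed

text \<open>The inner product on matrices is the entrywise (Frobenius) one. This identity underlies
  both nondegeneracy and the signs that determine the index.\<close>

lemma trace_form_transpose: "trace_form u (transpose u) = u \<bullet> u"
  by (simp add: trace_form_def trace_def transpose_def matrix_matrix_mult_def inner_vec_def)

lemma symmetric_bilinear_trace_form:
  "symmetric_bilinear_on W (left_translated_form trace_form A)"
  for A :: "real^'n^'n"
  by (auto simp: symmetric_bilinear_on_def left_translated_form_def trace_form_def
      matrix_mult_bilinear_simps trace_add trace_scaleR intro: trace_mul_sym)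

lemma nondegenerate_trace_form:
  fixes A :: "real^'n^'n"
  assumes "\<And>v. v \<in> V \<Longrightarrow> transpose v \<in> V" "A \<in> SL"
  shows "nondegenerate_on (left_translation V A) (left_translated_form trace_form A)"
  unfolding nondegenerate_on_def
proof (intro ballI impI)
  fix u assume "u \<in> left_translation V A"
    and 0: "\<forall>v\<in>left_translation V A. left_translated_form trace_form A u v = 0"
  then obtain a where a: "u = A ** a" "a \<in> V" by (auto simp: left_translation_def)
  then have "left_translated_form trace_form A u (A ** transpose a) = 0"
    using 0 assms(1) by (auto simp: left_translation_def)
  then have "a \<bullet> a = 0"
    by (simp add: left_translated_form_def a matrix_mul_assoc SL_inverse[OF assms(2)] trace_form_transpose)
  then show "u = 0" by (simp add: a matrix_mult_bilinear_simps)
qed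

lemma sub_pseudo_Riemannian_trace_form:
  fixes V :: "(real^'n^'n) set"
  assumes "subspace V" "V \<subseteq> {w. trace w = 0}" "\<And>v. v \<in> V \<Longrightarrow> transpose v \<in> V"
    and "{w. trace w = 0} \<subseteq> span (V \<union> {a ** b - b ** a | a b. a \<in> V \<and> b \<in> V})"
  shows "sub_pseudo_Riemannian_metric SL (left_translation V) (left_translated_form trace_form)"
  unfolding sub_pseudo_Riemannian_metric_def
proof (intro conjI ballI allI impI)
  show "\<exists>r. distribution SL r (left_translation V)"
    using distribution_SL[OF assms(1,2)] by blast
  show "bracket_generating SL (left_translation V)"
    by (rule bracket_generating_SL[OF assms(2,4)])
  fix X Y :: "real^'n^'n \<Rightarrow> real^'n^'n"
  assume "smooth_section SL (left_translation V) X" "smooth_section SL (left_translation V) Y"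
  then have X: "smooth_map_on SL X" and Y: "smooth_map_on SL Y" by (simp_all add: smooth_section_def)
  have inv: "smooth_map_on SL (\<lambda>y :: real^'n^'n. matrix_inv y)"
    by (rule smooth_map_on_matrix_inv[OF smooth_map_on_bounded_linear[OF bounded_linear_ident]])
       (simp add: SL_def)
  show "smooth_map_on SL (\<lambda>x. left_translated_form trace_form x (X x) (Y x))"
    unfolding left_translated_form_def trace_form_def
    by (rule smooth_map_on_trace[OF smooth_map_on_matrix_mult[OF
          smooth_map_on_matrix_mult[OF inv X] smooth_map_on_matrix_mult[OF inv Y]]])
qed (simp_all add: symmetric_bilinear_trace_form nondegenerate_trace_form assms(3))

text \<open>As \<open>trace\<close> is the inner product with \<open>mat 1\<close>, the tangent
  space is a translate of a hyperplane of dimension n^2 - 1.\<close>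

lemma corank_SL:
  fixes V :: "(real^'n^'n) set"
  assumes "A \<in> SL"
  shows "corank SL (left_translation V) A = CARD('n) * CARD('n) - 1 - dim V"
proof -
  have "trace w = mat 1 \<bullet> w" for w :: "real^'n^'n"
    by (simp add: trace_def inner_vec_def mat_def if_distrib[of "\<lambda>c. c * _"] cong: if_cong)
  moreover have "mat 1 \<noteq> (0 :: real^'n^'n)" by (simp add: mat_def vec_eq_iff)
  ultimately have "dim {w :: real^'n^'n. trace w = 0} = CARD('n) * CARD('n) - 1"
    using dim_hyperplane[of "mat 1 :: real^'n^'n"] by simp
  then show ?thesis
    by (simp add: corank_def dim_left_translation assms tangent_space_SL)
qed

section \<open>Trace form and matrix units\<close>

text \<open>Indexing by \<open>'n\<close> itself turns matrix units into standard basis vectors. The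
  numbering \<open>e\<close> is then needed only for the order of pairs and for
  \<open>Z_mat\<close>.\<close>

abbreviation E_mat :: "'n \<Rightarrow> 'n \<Rightarrow> real^'n^'n" where
  "E_mat i j \<equiv> axis i (axis j 1)"

lemma mat_unit_eq_E_mat: "mat_unit e p q = E_mat (e p) (e q)"
  by (auto simp: mat_unit_def vec_eq_iff axis_def)

lemma trace_E_mat: "trace (E_mat i j) = (if i = j then 1 else 0)" for i :: "'n::finite"
  by (simp add: trace_def axis_def if_distrib[of "\<lambda>v. v $ _"] cong: if_cong)

lemma transpose_E_mat: "transpose (E_mat i j) = E_mat j i"
  by (auto simp: transpose_def vec_eq_iff axis_def)

lemma E_mat_mult: "E_mat i j ** E_mat j i = E_mat i i" for i :: "'n::finite"
proof -
  have "(\<Sum>k\<in>UNIV. E_mat i j $ a $ k * E_mat j i $ k $ b)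
      = (\<Sum>k\<in>UNIV. if k = j then E_mat i i $ a $ b else 0)" for a b
    by (intro sum.cong) (auto simp: axis_def)
  then show ?thesis by (simp add: matrix_matrix_mult_def vec_eq_iff)
qed

lemma inner_E_mat: "E_mat i j \<bullet> E_mat k l = (if i = k \<and> j = l then 1 else 0)" for i :: "'n::finite"
  by (simp add: inner_axis_axis)

lemma E_mat_expansion: "w = (\<Sum>i\<in>UNIV. \<Sum>j\<in>UNIV. w $ i $ j *\<^sub>R E_mat i j)"
  for w :: "real^'n^'n"
proof -
  have "(\<Sum>i\<in>UNIV. \<Sum>j\<in>UNIV. w $ i $ j * E_mat i j $ a $ b)
      = (\<Sum>i\<in>UNIV. if i = a then \<Sum>j\<in>UNIV. if j = b then w $ i $ j else 0 else 0)" for a b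
    by (intro sum.cong refl) (auto simp: axis_def if_distrib[of "\<lambda>c. _ * c"]
        intro!: sum.cong sum.neutral cong: if_cong)
  then show ?thesis by (simp add: vec_eq_iff)
qed

lemma trace_0_in_span:
  fixes V :: "(real^'n^'n) set"
  assumes off: "\<And>i j. i \<noteq> j \<Longrightarrow> E_mat i j \<in> V"
  shows "{w. trace w = 0} \<subseteq> span (V \<union> {a ** b - b ** a | a b. a \<in> V \<and> b \<in> V})"
    (is "_ \<subseteq> span ?B")
proof
  fix w :: "real^'n^'n" assume "w \<in> {w. trace w = 0}"
  then have tr: "(\<Sum>i\<in>UNIV. w $ i $ i) = 0" by (simp add: trace_def)
  \<comment> \<open>Any reference index will do. In \<open>s\<close> every diagonal entry is
    compensated at position \<open>k\<close>; the corrections add up to \<open>trace w\<close> times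
    \<open>E_mat k k\<close>, which is zero.\<close>
  define k :: 'n where "k = undefined"
  define s where "s = (\<lambda>i j. if i = j then w $ i $ i *\<^sub>R (E_mat i i - E_mat k k) else w $ i $ j *\<^sub>R E_mat i j)"
  have diag: "E_mat i i - E_mat k k \<in> span ?B" for i
  proof (cases "i = k")
    case True
    then show ?thesis by (simp add: span_zero)
  next
    case False
    have "E_mat i i - E_mat k k = E_mat i k ** E_mat k i - E_mat k i ** E_mat i k"
      by (simp add: E_mat_mult)
    then have "E_mat i i - E_mat k k \<in> ?B" using off[of i k] off[of k i] False by blast
    then show ?thesis by (rule span_base)
  qed
  have "s i j \<in> span ?B" for i j
    using diag off[of i j] by (simp add: s_def span_scale span_base)
  then have "(\<Sum>i\<in>UNIV. \<Sum>j\<in>UNIV. s i j) \<in> span ?B" by (intro span_sum)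
  moreover have "(\<Sum>i\<in>UNIV. \<Sum>j\<in>UNIV. s i j) = w"
  proof -
    have "s i j = w $ i $ j *\<^sub>R E_mat i j - (if j = i then w $ i $ i *\<^sub>R E_mat k k else 0)" for i j
      by (simp add: s_def scaleR_diff_right)
    then have "(\<Sum>i\<in>UNIV. \<Sum>j\<in>UNIV. s i j)
        = (\<Sum>i\<in>UNIV. \<Sum>j\<in>UNIV. w $ i $ j *\<^sub>R E_mat i j) - (\<Sum>i\<in>UNIV. w $ i $ i) *\<^sub>R E_mat k k"
      by (simp add: sum_subtractf scaleR_left.sum)
    then show ?thesis using E_mat_expansion[of w] tr by simp
  qed
  ultimately show "w \<in> span ?B" by simp
qed

text \<open>Orthogonality of nonzero values gives injectivity as well as independence, so the
  dimension can be counted on the index set.\<close>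

lemma dim_orthogonal_family:
  fixes f :: "'i \<Rightarrow> 'a::euclidean_space"
  assumes "\<And>x. x \<in> P \<Longrightarrow> f x \<noteq> 0"
    and "\<And>x y. x \<in> P \<Longrightarrow> y \<in> P \<Longrightarrow> x \<noteq> y \<Longrightarrow> f x \<bullet> f y = 0"
  shows "dim (f ` P) = card P"
proof -
  have "inj_on f P"
    using assms by (intro inj_onI) (metis inner_eq_zero_iff)
  moreover have "independent (f ` P)"
    using assms
    by (intro pairwise_orthogonal_independent) (auto simp: pairwise_def orthogonal_def)
  ultimately show ?thesis by (simp add: dim_eq_card_independent card_image)
qed

section \<open>The index of the trace form\<close>

lemma neg_trace_form_of_skew:
  assumes "transpose v = - v" "v \<noteq> 0"
  shows "trace_form v v < 0"
proof -
  have "trace_form v v = - trace_form v (transpose v)"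
    using bounded_bilinear.minus_right[OF bounded_bilinear_matrix_mult, of v v]
      trace_scaleR[of "-1" "v ** v"]
    by (simp add: assms(1) trace_form_def)
  then show ?thesis using assms(2) by (simp add: trace_form_transpose)
qed

lemma linear_transpose: "linear (transpose :: real^'n^'n \<Rightarrow> real^'n^'n)"
  by (auto intro!: linearI simp: transpose_def vec_eq_iff)

text \<open>Sorting by the larger entry \<open>q\<close> leaves \<open>q - 1\<close> choices for
  \<open>p\<close>; the converse is there because \<open>SIGMA\<close> lists \<open>q\<close>
  first.\<close>

lemma card_less_pairs: "card {(p, q). 1 \<le> p \<and> p < q \<and> q \<le> (n::nat)} = n * (n - 1) div 2"
proof -
  have "{(p, q). 1 \<le> p \<and> p < q \<and> q \<le> n} = (SIGMA q:{1..n}. {1..<q})\<inverse>"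
    by auto
  then have "card {(p, q). 1 \<le> p \<and> p < q \<and> q \<le> n} = (\<Sum>q=1..n. q - 1)"
    by (simp add: card_SigmaI)
  also have "\<dots> = n * (n - 1) div 2"
  proof (induction n)
    case (Suc n)
    have "even (n * (n - 1))" by (cases n) auto
    then show ?case using Suc by (cases n) (auto simp: algebra_simps)
  qed simp
  finally show ?thesis .
qed

text \<open>The upper bound: a symmetric \<open>w\<close> has \<open>B(w, w) = |w|\<^sup>2 \<ge> 0\<close>, so on a negative definite subspace
  the map \<open>w \<mapsto> w - transpose w\<close> into the skew-symmetric matrices is injective.\<close>

lemma form_index_trace_form:
  fixes V :: "(real^'n^'n) set" and e :: "nat \<Rightarrow> 'n"
  assumes "subspace V" and e: "bij_betw e {1..n} UNIV"
    and off: "\<And>i j. i \<noteq> j \<Longrightarrow> E_mat i j \<in> V"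
  shows "form_index V trace_form = n * (n - 1) div 2"
proof -
  \<comment> \<open>The \<open>f (p, q)\<close> form an orthogonal basis of the skew-symmetric
    matrices; requiring \<open>p < q\<close> picks one from each pair of opposite matrices.\<close>
  define P where "P = {(p, q). 1 \<le> p \<and> p < q \<and> q \<le> n}"
  define f where "f = (\<lambda>(p, q). E_mat (e p) (e q) - E_mat (e q) (e p))"
  have e_eq: "e p = e q \<longleftrightarrow> p = q" if "p \<in> {1..n}" "q \<in> {1..n}" for p q
    using e that by (auto simp: bij_betw_def inj_on_eq_iff)
  have inner_f: "f x \<bullet> f y = (if x = y then 2 else 0)" if "x \<in> P" "y \<in> P" for x y
  proof -
    obtain p q r s where xy: "x = (p, q)" "y = (r, s)" by (meson surj_pair)
    with that have lt: "p < q" "r < s"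
      and mem: "p \<in> {1..n}" "q \<in> {1..n}" "r \<in> {1..n}" "s \<in> {1..n}"
      by (auto simp: P_def)
    have "f x \<bullet> f y = (if p = r \<and> q = s then 1 else 0) - (if q = r \<and> p = s then 1 else 0)
        - ((if p = s \<and> q = r then 1 else 0) - (if q = s \<and> p = r then 1 else 0))"
      unfolding xy f_def prod.case inner_diff_left inner_diff_right inner_E_mat
        e_eq[OF mem(1,3)] e_eq[OF mem(2,4)] e_eq[OF mem(1,4)] e_eq[OF mem(2,3)] ..
    \<comment> \<open>Two increasing pairs cannot be swaps of each other, so the cross terms drop
      out and each squared norm is 2.\<close>
    moreover from lt have "\<not> (p = s \<and> q = r)" by linarith
    ultimately show ?thesis unfolding xy prod.inject by argo
  qed
  have "dim (f ` P) = card P"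
  proof (rule dim_orthogonal_family)
    fix x assume "x \<in> P"
    then show "f x \<noteq> 0" using inner_f[of x x] by (metis inner_zero_left zero_neq_numeral)
  qed (simp add: inner_f)
  then have dimS: "dim (f ` P) = n * (n - 1) div 2"
    by (simp only: P_def card_less_pairs)
  define T where "T = (\<lambda>w :: real^'n^'n. w - transpose w)"
  have "linear T"
    unfolding T_def by (intro linear_compose_sub linear_id[unfolded id_def] linear_transpose)
  have T_E: "T (E_mat i j) \<in> span (f ` P)" for i j
  proof -
    obtain p q where pq: "i = e p" "p \<in> {1..n}" "j = e q" "q \<in> {1..n}"
      using e unfolding bij_betw_def by (metis UNIV_I imageE)
    consider "p < q" | "q < p" | "p = q" by linarith
    then show ?thesis
    proof cases
      case 1
      then have "T (E_mat i j) = f (p, q)" "(p, q) \<in> P"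
        using pq by (auto simp: T_def f_def P_def transpose_E_mat)
      then show ?thesis by (simp add: span_base)
    next
      case 2
      then have "T (E_mat i j) = - f (q, p)" "(q, p) \<in> P"
        using pq by (auto simp: T_def f_def P_def transpose_E_mat)
      then show ?thesis by (simp add: span_base span_neg)
    next
      case 3
      then show ?thesis using pq by (simp add: T_def transpose_E_mat span_zero)
    qed
  qed
  have T_span: "T w \<in> span (f ` P)" for w
  proof -
    have "T w = (\<Sum>i\<in>UNIV. \<Sum>j\<in>UNIV. w $ i $ j *\<^sub>R T (E_mat i j))"
      by (subst E_mat_expansion[of w])
        (simp add: linear_sum[OF \<open>linear T\<close>] linear_cmul[OF \<open>linear T\<close>])
    then show ?thesis by (simp add: span_sum span_scale T_E)
  qed
  have upper: "dim W \<le> n * (n - 1) div 2"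
    if W: "subspace W" "\<forall>w\<in>W. w \<noteq> 0 \<longrightarrow> trace_form w w < 0" for W :: "(real^'n^'n) set"
  proof -
    have "w = 0" if "w \<in> W" "T w = 0" for w
    proof (rule ccontr)
      assume "w \<noteq> 0"
      with W(2) that(1) have "trace_form w w < 0" by blast
      moreover have "trace_form w w = w \<bullet> w"
        using that(2) trace_form_transpose[of w] by (simp add: T_def)
      ultimately show False using inner_ge_zero[of w] by linarith
    qed
    then have "inj_on T (span W)"
      using W(1) \<open>linear T\<close> by (subst linear_inj_on_iff_eq_0) (auto simp: span_eq_iff[THEN iffD2])
    then have "dim W = dim (T ` W)"
      using dim_image_eq[OF \<open>linear T\<close>] by metis
    also have "\<dots> \<le> dim (f ` P)"
      by (metis T_span dim_span dim_subset image_subsetI)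
    finally show ?thesis by (simp add: dimS)
  qed
  have "f ` P \<subseteq> V"
  proof
    fix v assume "v \<in> f ` P"
    then obtain p q where "v = E_mat (e p) (e q) - E_mat (e q) (e p)" "(p, q) \<in> P"
      by (auto simp: f_def)
    moreover from this(2) have "e p \<noteq> e q" by (auto simp: P_def e_eq)
    ultimately show "v \<in> V" using off[of "e p" "e q"] off[of "e q" "e p"] assms(1)
      by (simp add: subspace_diff)
  qed
  then have sub: "span (f ` P) \<subseteq> V" using assms(1) by (rule span_minimal)
  have "transpose v = - v" if "v \<in> span (f ` P)" for v
    using that
  proof (rule span_induct)
    show "subspace {v :: real^'n^'n. transpose v = - v}"
      by (auto simp: subspace_def linear_add[OF linear_transpose] linear_cmul[OF linear_transpose]
          linear_0[OF linear_transpose])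
    fix v assume "v \<in> f ` P"
    then show "transpose v = - v"
      by (auto simp: f_def linear_diff[OF linear_transpose] transpose_E_mat)
  qed
  then have "\<forall>w\<in>span (f ` P). w \<noteq> 0 \<longrightarrow> trace_form w w < 0"
    using neg_trace_form_of_skew by blast
  with sub have attained: "n * (n - 1) div 2 \<in>
      {dim W | W. subspace W \<and> W \<subseteq> V \<and> (\<forall>w\<in>W. w \<noteq> 0 \<longrightarrow> trace_form w w < 0)}"
    using dimS by (intro CollectI exI[of _ "span (f ` P)"]) (simp add: dim_span)
  show ?thesis
    unfolding form_index_def
  proof (rule Max_eqI[OF _ _ attained])
    \<comment> \<open>\<open>Max\<close> is meaningful only on a finite set; the uniform bound
      \<open>upper\<close> provides finiteness as well as maximality.\<close>
    show "finite {dim W | W. subspace W \<and> W \<subseteq> V \<and> (\<forall>w\<in>W. w \<noteq> 0 \<longrightarrow> trace_form w w < 0)}"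
      by (rule finite_subset[of _ "{..n * (n - 1) div 2}"]) (use upper in auto)
  qed (use upper in auto)
qed

section \<open>The spaces \<open>D_space e I\<close>: generators, dimension, trace and
  transposition\<close>

lemma D_space_eq:
  fixes e :: "nat \<Rightarrow> 'n::finite"
  assumes e: "bij_betw e {1..CARD('n)} UNIV"
  shows "D_space e I = span ({E_mat i j | i j. i \<noteq> j} \<union> Z_mat e ` I)"
proof -
  let ?S = "{mat_unit e p q + mat_unit e q p | p q. 1 \<le> p \<and> p < q \<and> q \<le> CARD('n)}"
  let ?A = "{mat_unit e p q - mat_unit e q p | p q. 1 \<le> p \<and> p < q \<and> q \<le> CARD('n)}"
  let ?O = "{E_mat i j | i j :: 'n. i \<noteq> j}"
  have pair: "E_mat (e p) (e q) \<in> span (?S \<union> ?A \<union> Z_mat e ` I) \<and>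
      E_mat (e q) (e p) \<in> span (?S \<union> ?A \<union> Z_mat e ` I)"
    if "1 \<le> p" "p < q" "q \<le> CARD('n)" for p q
  proof -
    let ?s = "mat_unit e p q + mat_unit e q p" and ?a = "mat_unit e p q - mat_unit e q p"
    have sa: "?s \<in> span (?S \<union> ?A \<union> Z_mat e ` I)" "?a \<in> span (?S \<union> ?A \<union> Z_mat e ` I)"
      using that by (auto intro!: span_base)
    \<comment> \<open>Half the sum and half the difference recover the two matrix units, giving
      generators free of the order on indices and orthogonal to every
      \<open>Z_mat e l\<close>.\<close>
    have "(1/2) *\<^sub>R (?s + ?a) \<in> span (?S \<union> ?A \<union> Z_mat e ` I)"
      "(1/2) *\<^sub>R (?s - ?a) \<in> span (?S \<union> ?A \<union> Z_mat e ` I)"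
      by (rule span_scale[OF span_add[OF sa]], rule span_scale[OF span_diff[OF sa]])
    moreover have "(1/2) *\<^sub>R (?s + ?a) = mat_unit e p q" "(1/2) *\<^sub>R (?s - ?a) = mat_unit e q p"
      by (simp_all add: vec_eq_iff)
    ultimately show ?thesis by (simp add: mat_unit_eq_E_mat)
  qed
  have "?O \<subseteq> span (?S \<union> ?A \<union> Z_mat e ` I)"
  proof
    fix v assume "v \<in> ?O"
    then obtain i j where v: "v = E_mat i j" "i \<noteq> j" by blast
    obtain p q where pq: "i = e p" "p \<in> {1..CARD('n)}" "j = e q" "q \<in> {1..CARD('n)}"
      using e unfolding bij_betw_def by (metis UNIV_I imageE)
    with v(2) consider "p < q" | "q < p" by (metis linorder_neqE_nat)
    then show "v \<in> span (?S \<union> ?A \<union> Z_mat e ` I)"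
      using pair[of p q] pair[of q p] pq v(1) by cases auto
  qed
  moreover have "Z_mat e ` I \<subseteq> span (?S \<union> ?A \<union> Z_mat e ` I)"
    by (auto intro: span_base)
  moreover have "?S \<union> ?A \<subseteq> span (?O \<union> Z_mat e ` I)"
  proof -
    have "E_mat (e p) (e q) \<in> span (?O \<union> Z_mat e ` I)"
      if "p \<noteq> q" "p \<in> {1..CARD('n)}" "q \<in> {1..CARD('n)}" for p q
    proof -
      have "e p \<noteq> e q" using that e by (auto simp: bij_betw_def inj_on_eq_iff)
      then show ?thesis by (intro span_base) blast
    qed
    then show ?thesis
      by (auto simp: mat_unit_eq_E_mat intro!: span_add span_diff)
  qed
  moreover have "Z_mat e ` I \<subseteq> span (?O \<union> Z_mat e ` I)"
    by (auto intro: span_base)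
  ultimately show ?thesis
    unfolding D_space_def span_eq[symmetric] by (simp add: span_eq)
qed

lemma Z_mat_eq:
  fixes e :: "nat \<Rightarrow> 'n::finite"
  shows "Z_mat e l = E_mat (e (CARD('n) - 1)) (e (CARD('n) - 1)) - E_mat (e l) (e l)"
  by (simp add: Z_mat_def mat_unit_eq_E_mat)

text \<open>Off-diagonal units are orthogonal to diagonal matrices, so the n^2 - n units and the
  \<open>Z_mat e l\<close> contribute separately. The latter share the summand
  \<open>E_mat k k\<close> and are not mutually orthogonal, so their independence takes a
  projection.\<close>

lemma dim_D_space:
  fixes e :: "nat \<Rightarrow> 'n::finite"
  assumes e: "bij_betw e {1..CARD('n)} UNIV" and I: "I \<subseteq> {1..CARD('n) - 2}" and "CARD('n) \<ge> 2"
  shows "dim (D_space e I) = CARD('n) * CARD('n) - CARD('n) + card I"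
proof -
  let ?O = "{E_mat i j | i j :: 'n. i \<noteq> j}"
  define k where "k = e (CARD('n) - 1)"
  have e_eq: "e p = e q \<longleftrightarrow> p = q" if "p \<in> {1..CARD('n)}" "q \<in> {1..CARD('n)}" for p q
    using e that by (auto simp: bij_betw_def inj_on_eq_iff)
  have finI: "finite I" using I finite_subset by blast
  \<comment> \<open>The bound \<open>l \<le> CARD('n) - 2\<close> keeps \<open>l\<close> away from
    the position \<open>CARD('n) - 1\<close> of \<open>k\<close>.\<close>
  have I': "l \<in> {1..CARD('n)}" "e l \<noteq> k" if "l \<in> I" for l
    using I that assms(3) by (force simp: k_def e_eq)+
  have "x \<bullet> y = 0" if "x \<in> ?O" "y \<in> Z_mat e ` I" for x y
    using that by (auto simp: Z_mat_eq inner_diff_right inner_E_mat)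
  then have "dim (?O \<union> Z_mat e ` I) = dim ?O + dim (Z_mat e ` I)"
    by (rule dim_orthogonal_sum)
  moreover have "dim ?O = CARD('n) * CARD('n) - CARD('n)"
  proof -
    have "?O = (\<lambda>(i, j). E_mat i j) ` (UNIV - Id)" by auto
    moreover have "dim ((\<lambda>(i :: 'n, j). E_mat i j) ` (UNIV - Id)) = card (UNIV - (Id :: ('n \<times> 'n) set))"
      by (rule dim_orthogonal_family) (auto simp: inner_E_mat axis_eq_0_iff split: if_splits)
    moreover have "card (UNIV - (Id :: ('n \<times> 'n) set)) = CARD('n) * CARD('n) - CARD('n)"
    proof -
      have "(Id :: ('n \<times> 'n) set) = (\<lambda>i. (i, i)) ` UNIV" by auto
      moreover have "inj (\<lambda>i :: 'n. (i, i))" by (simp add: inj_on_def)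
      ultimately have "card (Id :: ('n \<times> 'n) set) = CARD('n)" using card_image by metis
      then show ?thesis by (simp add: card_Diff_subset)
    qed
    ultimately show ?thesis by simp
  qed
  moreover have "dim (Z_mat e ` I) = card I"
  proof (rule antisym)
    show "dim (Z_mat e ` I) \<le> card I"
      using dim_le_card'[of "Z_mat e ` I"] card_image_le[OF finI, of "Z_mat e"] finI by simp
    define \<pi> where "\<pi> = (\<lambda>M :: real^'n^'n. \<chi> a b. if a = k then 0 else M $ a $ b)"
    have "linear \<pi>" unfolding \<pi>_def by (auto intro!: linearI simp: vec_eq_iff)
    have "\<pi> (Z_mat e l) = - E_mat (e l) (e l)" if "l \<in> I" for l
    proof -
      have "Z_mat e l = E_mat k k - E_mat (e l) (e l)" by (simp only: Z_mat_eq k_def)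
      then show ?thesis using I'(2)[OF that] by (auto simp: \<pi>_def vec_eq_iff axis_def)
    qed
    then have "\<pi> ` Z_mat e ` I = (\<lambda>l. - E_mat (e l) (e l)) ` I"
      by (simp add: image_image)
    moreover have "e l = e m \<longleftrightarrow> l = m" if "l \<in> I" "m \<in> I" for l m
      using that by (intro e_eq I')
    then have "dim ((\<lambda>l. - E_mat (e l) (e l)) ` I) = card I"
      by (intro dim_orthogonal_family) (auto simp: inner_E_mat)
    ultimately show "card I \<le> dim (Z_mat e ` I)"
      using dim_image_le[OF \<open>linear \<pi>\<close>, of "Z_mat e ` I"] by simp
  qed
  ultimately show ?thesis by (simp add: D_space_eq[OF e])
qed

lemma D_space_trace_0:
  fixes e :: "nat \<Rightarrow> 'n::finite"
  assumes e: "bij_betw e {1..CARD('n)} UNIV"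
  shows "D_space e I \<subseteq> {w. trace w = 0}"
  unfolding D_space_eq[OF e]
  by (rule span_minimal[OF _ subspace_trace_0]) (auto simp: trace_E_mat Z_mat_eq trace_sub)

text \<open>Transposition swaps the off-diagonal units and fixes each \<open>Z_mat e l\<close>, so
  it maps the generating set into itself.\<close>

lemma D_space_transpose:
  fixes e :: "nat \<Rightarrow> 'n::finite"
  assumes e: "bij_betw e {1..CARD('n)} UNIV" and "v \<in> D_space e I"
  shows "transpose v \<in> D_space e I"
proof -
  let ?G = "{E_mat i j | i j :: 'n. i \<noteq> j} \<union> Z_mat e ` I"
  have "transpose g \<in> ?G" if "g \<in> ?G" for g
    using that
  proof
    assume "g \<in> {E_mat i j | i j :: 'n. i \<noteq> j}"
    then obtain i j where "g = E_mat i j" "i \<noteq> j" by blast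
    then have "transpose g = E_mat j i" "j \<noteq> i" by (simp_all add: transpose_E_mat)
    then show ?thesis by blast
  next
    assume "g \<in> Z_mat e ` I"
    then have "transpose g = g"
      by (auto simp: transpose_E_mat Z_mat_eq linear_diff[OF linear_transpose])
    then show ?thesis using that by simp
  qed
  then have "transpose ` ?G \<subseteq> ?G" by (rule image_subsetI)
  then have "transpose ` span ?G \<subseteq> span ?G"
    unfolding linear_span_image[OF linear_transpose, symmetric] by (rule span_mono)
  with assms(2) show ?thesis unfolding D_space_eq[OF e] by (meson image_subset_iff)
qed

theorem theorem3p7:
  fixes n :: nat and e :: "nat \<Rightarrow> 'n::finite" and I :: "nat set"
  assumes "CARD('n) = n" and "n \<ge> 3"
    and "bij_betw e {1..n} (UNIV :: 'n set)"
    and "I \<subseteq> {1..n - 2}"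
  shows "sub_pseudo_Riemannian_metric SL
           (left_translation (D_space e I)) (left_translated_form trace_form) \<and>
         bi_invariant_metric SL
           (left_translation (D_space e I)) (left_translated_form trace_form) \<and>
         (\<forall>A\<in>SL. corank SL (left_translation (D_space e I)) A = n - 1 - card I) \<and>
         form_index (D_space e I) trace_form = n * (n - 1) div 2"
proof (intro conjI ballI)
  have e: "bij_betw e {1..CARD('n)} UNIV" using assms(1,3) by simp
  have off: "E_mat i j \<in> D_space e I" if "i \<noteq> j" for i j
    unfolding D_space_eq[OF e] using that by (intro span_base) blast
  have sub: "subspace (D_space e I)" by (simp add: D_space_def)
  show "sub_pseudo_Riemannian_metric SL
      (left_translation (D_space e I)) (left_translated_form trace_form)"
    by (rule sub_pseudo_Riemannian_trace_form[OF sub D_space_trace_0[OF e] D_space_transpose[OF e]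
          trace_0_in_span[OF off]])
  show "bi_invariant_metric SL (left_translation (D_space e I)) (left_translated_form trace_form)"
    by (rule bi_invariant_trace_form)
  show "form_index (D_space e I) trace_form = n * (n - 1) div 2"
    by (rule form_index_trace_form[OF sub assms(3) off])
  fix A :: "real^'n^'n" assume "A \<in> SL"
  have "dim (D_space e I) = n * n - n + card I"
    using dim_D_space[OF e] assms by simp
  \<comment> \<open>Subtraction is truncated: \<open>n \<le> n * n\<close> makes
    \<open>n * n - n\<close> a true difference, and the rest is linear with \<open>n * n\<close> as
    an atom.\<close>
  moreover have "n * n - 1 - (n * n - n + card I) = n - 1 - card I"
    using le_square[of n] by linarith
  ultimately show "corank SL (left_translation (D_space e I)) A = n - 1 - card I"
    using corank_SL[OF \<open>A \<in> SL\<close>, of "D_space e I"] assms(1) by metis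
qed

end
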